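(* Let $E$ be an $AL$-space and let $F$ be a Banach lattice whose dual $F'$ is order continuous. Then for every sequentially $uaw$-compact operator $T\colon E\to F$, the adjoint $T'\colon F'\to E'$ is sequentially $uaw$-compact.
   Context: A net $(x_\alpha)$ in a Banach lattice $G$ is $uaw$-convergent to $x$ if $|x_\alpha-x|\wedge u\to 0$ weakly for every $u\in G_+$. A bounded operator $T\colon X\to G$ from a Banach space into a Banach lattice is sequentially $uaw$-compact if for every bounded sequence $(x_n)$ in $X$, the sequence $(Tx_n)$ has a subsequence that is $uaw$-convergent in $G$. *)

theory Defs
  imports "HOL-Analysis.Analysis"
begin

definition lat_abs :: "'a::{lattice, uminus} \<Rightarrow> 'a" where
  "lat_abs x = sup x (- x)"

class banach_lattice = banach + ordered_real_vector + lattice +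
  assumes lattice_norm: "sup x (- x) \<le> sup y (- y) \<Longrightarrow> norm x \<le> norm y"

definition AL_space :: "'a::banach_lattice itself \<Rightarrow> bool" where
  "AL_space _ \<longleftrightarrow> (\<forall>x y::'a. 0 \<le> x \<longrightarrow> 0 \<le> y \<longrightarrow> norm (x + y) = norm x + norm y)"

text \<open>Order continuous norm: every downward directed set D with infimum 0
  (i.e. a net decreasing to 0) has norms decreasing to 0.\<close>
definition order_continuous :: "'a::banach_lattice itself \<Rightarrow> bool" where
  "order_continuous _ \<longleftrightarrow>
     (\<forall>D::'a set. D \<noteq> {}
        \<and> (\<forall>x\<in>D. \<forall>y\<in>D. \<exists>z\<in>D. z \<le> x \<and> z \<le> y)
        \<and> (\<forall>x\<in>D. 0 \<le> x) \<and> (\<forall>w. (\<forall>x\<in>D. w \<le> x) \<longrightarrow> w \<le> 0)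
        \<longrightarrow> (\<forall>e>0. \<exists>x\<in>D. norm x < e))"

definition uaw_convergent_to :: "(nat \<Rightarrow> 'a::banach_lattice) \<Rightarrow> 'a \<Rightarrow> bool" where
  "uaw_convergent_to xs x \<longleftrightarrow>
     (\<forall>u. 0 \<le> u \<longrightarrow> (\<forall>\<phi>::'a \<Rightarrow>\<^sub>L real.
        (\<lambda>n. blinfun_apply \<phi> (inf (lat_abs (xs n - x)) u)) \<longlonglongrightarrow> 0))"

definition seq_uaw_compact :: "('a::real_normed_vector \<Rightarrow> 'b::banach_lattice) \<Rightarrow> bool" where
  "seq_uaw_compact T \<longleftrightarrow>
     (\<forall>xs::nat \<Rightarrow> 'a. bounded (range xs) \<longrightarrow>
        (\<exists>r y. strict_mono r \<and> uaw_convergent_to (\<lambda>n. T (xs (r n))) y))"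

text \<open>J realises the Banach-lattice dual of 'a on the type 'd: J is a linear
  isometric bijection onto the norm dual ('a \<Rightarrow>L real) which is an order
  isomorphism for the dual order (f \<ge> 0 iff f x \<ge> 0 for all x \<ge> 0).\<close>
definition dual_repr :: "('d::banach_lattice \<Rightarrow> ('a::banach_lattice \<Rightarrow>\<^sub>L real)) \<Rightarrow> bool" where
  "dual_repr J \<longleftrightarrow> linear J \<and> bij J \<and> (\<forall>f. norm (J f) = norm f)
     \<and> (\<forall>f. 0 \<le> f \<longleftrightarrow> (\<forall>x. 0 \<le> x \<longrightarrow> 0 \<le> blinfun_apply (J f) x))"

text \<open>Adjoint T' : F' \<rightarrow> E', transported along the dual representations.\<close>
definition adjoint_op ::
  "('ed \<Rightarrow> ('e::real_normed_vector \<Rightarrow>\<^sub>L real)) \<Rightarrow> ('fd \<Rightarrow> ('f::real_normed_vector \<Rightarrow>\<^sub>L real))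
     \<Rightarrow> ('e \<Rightarrow>\<^sub>L 'f) \<Rightarrow> 'fd \<Rightarrow> 'ed" where
  "adjoint_op JE JF T g = inv JE (JF g o\<^sub>L T)"

end

theory Submission
  imports Defs "HOL-Library.Lattice_Algebras"
begin

text \<open>
  Order continuity of \<open>F'\<close> turns bounded \<open>uaw\<close>-convergent sequences of \<open>F\<close> into weakly convergent
  ones, so \<open>T\<close> maps bounded sequences to sequences with weakly convergent subsequences. Given
  bounded \<open>f n\<close> in \<open>F'\<close> with weak-star cluster point \<open>f0\<close>, put \<open>G n = T' (f n - f0)\<close> and choose a
  subsequence of \<open>f n\<close> converging to \<open>f0\<close> on \<open>T c\<close> for countably many test vectors \<open>c\<close>. If the
  \<open>T' (f n)\<close> along it are not \<open>uaw\<close>-convergent to \<open>T' f0\<close>, then, since \<open>E'\<close> is an AM-space with unit, finitely many of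
  the \<open>G n\<close> at a time are bounded below by a fixed \<open>d > 0\<close> at a common point of the unit ball, which may be
  taken among the test vectors. A weak limit \<open>z\<close> of the images of these points under \<open>T\<close> satisfies
  \<open>(f n - f0) z \<ge> d / 2\<close> along a further subsequence, whereas any weak-star cluster point of
  the \<open>f n - f0\<close> vanishes at the images of the test vectors and hence at \<open>z\<close>.
\<close>

subsection \<open>Banach lattices\<close>

subclass (in banach_lattice) lattice_ab_group_add ..

text \<open>Distributivity comes from the group identity \<open>inf x y = x + y - sup x y\<close>:
  enlarging the supremum to \<open>s\<close> bounds \<open>b\<close> and \<open>c\<close> by the
  same element \<open>m - a + s\<close>.\<close>

lemma inf_sup_distrib_lattice_group:
  fixes a b c :: "'a::lattice_ab_group_add"
  shows "inf a (sup b c) = sup (inf a b) (inf a c)"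
proof (rule order.antisym)
  define m s where "m = sup (inf a b) (inf a c)" and "s = sup a (sup b c)"
  have inf_eq: "inf x y = x + y - sup x y" for x y :: 'a
    using add_eq_inf_sup[of x y] by (simp add: algebra_simps del: diff_sup_eq_inf)
  have *: "x \<le> m - a + s" if "x = b \<or> x = c" for x
  proof -
    have "sup a x \<le> s" using that by (auto simp: s_def intro: le_supI2)
    then have "a + x - s \<le> a + x - sup a x"
      by (intro diff_left_mono)
    also have "\<dots> = inf a x"
      by (rule inf_eq[symmetric])
    also have "\<dots> \<le> m"
      using that by (auto simp: m_def)
    finally show ?thesis
      by (simp add: algebra_simps)
  qed
  then have "sup b c \<le> m - a + s" by simp
  moreover have "inf a (sup b c) = a + sup b c - s"
    unfolding s_def by (rule inf_eq)
  ultimately show "inf a (sup b c) \<le> sup (inf a b) (inf a c)"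
    unfolding m_def[symmetric] by (simp only: diff_le_eq) (simp add: algebra_simps)
qed (auto intro: le_infI2)

section \<open>Absolute values and monotonicity of the norm\<close>

lemma lat_abs_ge:
  fixes x :: "'a::lattice_ab_group_add"
  shows "x \<le> lat_abs x" "- x \<le> lat_abs x" "0 \<le> lat_abs x"
proof -
  show *: "x \<le> lat_abs x" "- x \<le> lat_abs x" by (auto simp: lat_abs_def)
  have "0 \<le> lat_abs x + lat_abs x" using add_mono[OF *] by simp
  then show "0 \<le> lat_abs x" by simp
qed

lemma lat_abs_le_iff:
  fixes x :: "'a::lattice_ab_group_add"
  shows "lat_abs x \<le> y \<longleftrightarrow> x \<le> y \<and> - x \<le> y"
  by (simp add: lat_abs_def)

lemma lat_abs_of_nonneg:
  fixes x :: "'a::lattice_ab_group_add"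
  shows "0 \<le> x \<Longrightarrow> lat_abs x = x"
  by (metis lat_abs_le_iff lat_abs_ge(1) minus_le_self_iff order.antisym order_refl)

lemma lattice_norm_lat_abs:
  fixes x y :: "'a::banach_lattice"
  shows "lat_abs x \<le> lat_abs y \<Longrightarrow> norm x \<le> norm y"
  unfolding lat_abs_def by (rule lattice_norm)

lemma norm_lat_abs [simp]:
  fixes x :: "'a::banach_lattice"
  shows "norm (lat_abs x) = norm x"
  by (intro order.antisym lattice_norm_lat_abs) (simp_all add: lat_abs_of_nonneg lat_abs_ge(3))

lemma norm_mono_nonneg:
  fixes x y :: "'a::banach_lattice"
  shows "0 \<le> x \<Longrightarrow> x \<le> y \<Longrightarrow> norm x \<le> norm y"
  by (rule lattice_norm_lat_abs) (simp add: lat_abs_of_nonneg order_trans[of 0 x y])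

lemma norm_le_if_lat_abs_le:
  fixes x y :: "'a::banach_lattice"
  assumes "lat_abs x \<le> y"
  shows "norm x \<le> norm y"
  using norm_mono_nonneg[OF lat_abs_ge(3) assms] by simp

section \<open>Positive parts, truncation and disjointness\<close>

lemma pprt_diff_le:
  fixes a b :: "'a::lattice_ab_group_add"
  assumes "0 \<le> b" "0 \<le> a"
  shows "pprt (a - b) \<le> a"
  using assms by (simp add: pprt_def algebra_simps)

lemma diff_pprt_diff:
  fixes a b :: "'a::lattice_ab_group_add"
  shows "a - pprt (a - b) = inf a b"
proof -
  have "a - pprt (a - b) = a + inf (b - a) 0"
    unfolding pprt_def by (simp add: algebra_simps)
  then show ?thesis
    by (simp add: add_inf_distrib_left inf_commute)
qed

lemma inf_pprt_uminus:
  fixes a :: "'a::lattice_ab_group_add"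
  shows "inf (pprt a) (pprt (- a)) = 0"
proof -
  have "pprt a = a + pprt (- a)"
    using prts[of a] by (simp add: pprt_neg algebra_simps)
  then have "inf (pprt a) (pprt (- a)) = inf (a + pprt (- a)) (0 + pprt (- a))"
    by simp
  also have "\<dots> = inf a 0 + pprt (- a)"
    by (simp only: add_inf_distrib_right)
  finally have "inf (pprt a) (pprt (- a)) = inf a 0 + pprt (- a)" .
  then show ?thesis
    by (simp only: pprt_neg) (simp add: nprt_def del: neg_inf_eq_sup)
qed

text \<open>The right side is the infimum of the four sums \<open>a + a\<close>,
  \<open>b + a\<close>, \<open>a + c\<close> and \<open>b + c\<close>, each of which dominates the
  left side.\<close>

lemma inf_add_le:
  fixes a b c :: "'a::lattice_ab_group_add"
  assumes "0 \<le> a" "0 \<le> b" "0 \<le> c"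
  shows "inf a (b + c) \<le> inf a b + inf a c"
proof -
  have "inf a b + inf a c = inf (inf (a + a) (b + a)) (inf (a + c) (b + c))"
    by (simp only: add_inf_distrib_right add_inf_distrib_left)
  moreover have "inf a (b + c) \<le> inf (inf (a + a) (b + a)) (inf (a + c) (b + c))"
    using assms by (auto intro: le_infI1 add_increasing add_increasing2)
  ultimately show ?thesis by simp
qed

section \<open>Scalar multiples and lattice operations\<close>

lemma scaleR_inf_distrib:
  fixes a b :: "'a::banach_lattice"
  assumes "0 < c"
  shows "c *\<^sub>R inf a b = inf (c *\<^sub>R a) (c *\<^sub>R b)"
proof (rule order.antisym)
  have "(1/c) *\<^sub>R inf (c *\<^sub>R a) (c *\<^sub>R b) \<le> (1/c) *\<^sub>R (c *\<^sub>R x)" if "x = a \<or> x = b" for x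
    using that assms by (intro scaleR_left_mono) auto
  then have "(1/c) *\<^sub>R inf (c *\<^sub>R a) (c *\<^sub>R b) \<le> inf a b"
    using assms by auto
  from scaleR_left_mono[OF this, of c] show "inf (c *\<^sub>R a) (c *\<^sub>R b) \<le> c *\<^sub>R inf a b"
    using assms by simp
qed (use assms in \<open>auto intro: scaleR_left_mono\<close>)

lemma scaleR_pprt:
  fixes a :: "'a::banach_lattice"
  assumes "0 < c"
  shows "pprt (c *\<^sub>R a) = c *\<^sub>R pprt a"
  using scaleR_inf_distrib[OF assms, of "- a" 0]
  by (metis neg_inf_eq_sup minus_zero minus_minus pprt_def scaleR_minus_right scaleR_zero_right)

text \<open>Raising both factors to \<open>d = max 1 c\<close> only enlarges the infimum, and a
  common factor can be pulled out.\<close>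

lemma inf_eq_0_scaleR:
  fixes a b :: "'a::banach_lattice"
  assumes "inf a b = 0" "0 < c"
  shows "inf a (c *\<^sub>R b) = 0"
proof -
  have ab: "0 \<le> a" "0 \<le> b" using assms by (metis inf_le1 inf_le2)+
  define d where "d = max 1 c"
  have d: "0 < d" "1 \<le> d" "c \<le> d" by (auto simp: d_def)
  have "a \<le> d *\<^sub>R a" using scaleR_right_mono[of 1 d a] d ab by simp
  moreover have "c *\<^sub>R b \<le> d *\<^sub>R b" using scaleR_right_mono[of c d b] d ab by simp
  ultimately have "inf a (c *\<^sub>R b) \<le> inf (d *\<^sub>R a) (d *\<^sub>R b)"
    by (intro inf_mono)
  also have "\<dots> = 0" using scaleR_inf_distrib[OF d(1), of a b] assms by simp
  finally show ?thesis
    using ab assms by (intro order.antisym) (auto intro: scaleR_nonneg_nonneg)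
qed

lemma archimedean_le_0:
  fixes w b :: "'a::banach_lattice"
  assumes "\<And>n::nat. real n *\<^sub>R w \<le> b"
  shows "w \<le> 0"
proof -
  have *: "real n * norm (pprt w) \<le> norm (pprt b)" for n
  proof (cases "n = 0")
    case False
    have "pprt (real n *\<^sub>R w) \<le> pprt b" by (rule pprt_mono) (rule assms)
    moreover have "pprt (real n *\<^sub>R w) = real n *\<^sub>R pprt w" using False by (intro scaleR_pprt) simp
    ultimately have "norm (real n *\<^sub>R pprt w) \<le> norm (pprt b)"
      by (intro norm_mono_nonneg) (simp_all add: scaleR_nonneg_nonneg)
    then show ?thesis by simp
  qed simp
  have "norm (pprt w) = 0"
  proof (rule ccontr)
    assume "norm (pprt w) \<noteq> 0"
    then obtain n where "norm (pprt b) < real n * norm (pprt w)"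
      using reals_Archimedean3[of "norm (pprt w)"] by auto
    then show False using *[of n] by simp
  qed
  then show ?thesis by (simp add: le_zero_iff_zero_pprt)
qed

text \<open>The cone is closed because \<open>norm (pprt (- x))\<close> is at most the distance from
  \<open>x\<close> to any nonnegative \<open>X n\<close>.\<close>

lemma LIMSEQ_nonneg:
  fixes X :: "nat \<Rightarrow> 'a::banach_lattice"
  assumes "X \<longlonglongrightarrow> x" "\<forall>\<^sub>F n in sequentially. 0 \<le> X n"
  shows "0 \<le> x"
proof -
  have "\<forall>\<^sub>F n in sequentially. norm (pprt (- x)) \<le> norm (X n - x)"
    using assms(2)
  proof eventually_elim
    case (elim n)
    have "- x \<le> X n - x" using elim by simp
    then have "- x \<le> lat_abs (X n - x)" using lat_abs_ge(1) by (rule order_trans)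
    then have "pprt (- x) \<le> lat_abs (X n - x)"
      unfolding pprt_def using lat_abs_ge[of "X n - x"] by (intro le_supI)
    from norm_mono_nonneg[OF _ this] show ?case by simp
  qed
  moreover have "(\<lambda>n. norm (X n - x)) \<longlonglongrightarrow> 0"
    using assms(1) by (simp add: LIM_zero tendsto_norm_zero)
  ultimately have "norm (pprt (- x)) \<le> 0"
    by (intro tendsto_lowerbound[of "\<lambda>n. norm (X n - x)"]) auto
  then show ?thesis by (simp flip: le_zero_iff_zero_pprt)
qed

lemma le_suminf_nonneg:
  fixes f :: "nat \<Rightarrow> 'a::banach_lattice"
  assumes "summable f" "\<And>n. 0 \<le> f n"
  shows "f m \<le> suminf f"
proof -
  have "(\<lambda>n. sum f {..<n} - f m) \<longlonglongrightarrow> suminf f - f m"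
    using assms(1) by (intro tendsto_intros summable_LIMSEQ)
  moreover have "\<forall>\<^sub>F n in sequentially. 0 \<le> sum f {..<n} - f m"
  proof (rule eventually_sequentiallyI)
    fix n assume "Suc m \<le> n"
    then have "sum f {..<n} = f m + sum f ({..<n} - {m})"
      by (intro sum.remove) auto
    moreover have "0 \<le> sum f ({..<n} - {m})"
      by (intro sum_nonneg assms)
    ultimately show "0 \<le> sum f {..<n} - f m" by simp
  qed
  ultimately have "0 \<le> suminf f - f m" by (rule LIMSEQ_nonneg)
  then show ?thesis by simp
qed

text \<open>Kantorovich's extension: every vector is a difference of nonnegative ones, and
  additivity makes \<open>q a - q b\<close> independent of the chosen difference.\<close>

lemma extend_from_cone:
  fixes q :: "'a::banach_lattice \<Rightarrow> real"
  assumes add: "\<And>x y. 0 \<le> x \<Longrightarrow> 0 \<le> y \<Longrightarrow> q (x + y) = q x + q y"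
    and scale: "\<And>c x. 0 < c \<Longrightarrow> 0 \<le> x \<Longrightarrow> q (c *\<^sub>R x) = c * q x"
    and bound: "\<And>x. 0 \<le> x \<Longrightarrow> \<bar>q x\<bar> \<le> M * norm x"
  obtains f :: "'a \<Rightarrow>\<^sub>L real" where "\<And>x. 0 \<le> x \<Longrightarrow> blinfun_apply f x = q x"
proof -
  define f where "f x = q (pprt x) - q (pprt (- x))" for x
  have parts: "x = pprt x - pprt (- x)" for x :: 'a
    using prts[of x] by (simp add: pprt_neg)
  have q0: "q 0 = 0" using add[of 0 0] by simp
  have f_eq: "f x = q a - q b" if "x = a - b" "0 \<le> a" "0 \<le> b" for x a b
  proof -
    have "pprt x + b = a + pprt (- x)"
      using that parts[of x] by (metis add.commute diff_add_eq diff_eq_eq)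
    then have "q (pprt x + b) = q (a + pprt (- x))" by simp
    then show ?thesis using that by (simp add: add f_def)
  qed
  have f_add: "f (x + y) = f x + f y" for x y
  proof -
    have "x + y = (pprt x + pprt y) - (pprt (- x) + pprt (- y))"
      using parts[of x] parts[of y] by (metis add_diff_add)
    then have "f (x + y) = q (pprt x + pprt y) - q (pprt (- x) + pprt (- y))"
      by (rule f_eq) auto
    then show ?thesis by (simp add: add f_def)
  qed
  have f_uminus: "f (- x) = - f x" for x by (simp add: f_def)
  have f_pos: "f (c *\<^sub>R x) = c * f x" if "0 < c" for c x
    using that scaleR_pprt[OF that, of x] scaleR_pprt[OF that, of "- x"]
    by (simp add: f_def scale algebra_simps)
  have f_scale: "f (c *\<^sub>R x) = c * f x" for c x
  proof -
    consider "c = 0" | "0 < c" | "0 < - c" by linarith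
    then show ?thesis
    proof cases
      case 1 then show ?thesis by (simp add: f_def)
    next
      case 2 then show ?thesis by (rule f_pos)
    next
      case 3 then show ?thesis using f_pos[OF 3, of x] f_uminus[of "c *\<^sub>R x"] by simp
    qed
  qed
  have M: "norm (pprt x) \<le> norm x" for x :: 'a
    by (rule norm_le_if_lat_abs_le[of "pprt x" "lat_abs x", simplified])
      (auto simp: lat_abs_of_nonneg pprt_def lat_abs_ge)
  have "norm (f x) \<le> norm x * (2 * \<bar>M\<bar>)" for x
  proof -
    have "\<bar>q (pprt y)\<bar> \<le> \<bar>M\<bar> * norm y" for y
    proof -
      have "\<bar>q (pprt y)\<bar> \<le> M * norm (pprt y)" by (rule bound) simp
      also have "\<dots> \<le> \<bar>M\<bar> * norm y" by (intro mult_mono M) auto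
      finally show ?thesis .
    qed
    from this[of x] this[of "- x"] have "\<bar>f x\<bar> \<le> \<bar>M\<bar> * norm x + \<bar>M\<bar> * norm x"
      unfolding f_def by (simp del: abs_le_iff)
    then show ?thesis by (simp add: algebra_simps)
  qed
  then have bl: "bounded_linear f"
    by (intro bounded_linear_intro[of f "2 * \<bar>M\<bar>"]) (simp_all add: f_add f_scale)
  show thesis
  proof
    show "blinfun_apply (Blinfun f) x = q x" if "0 \<le> x" for x
      using that bounded_linear_Blinfun_apply[OF bl] by (simp add: f_def q0)
  qed
qed

subsection \<open>Weak-star cluster points\<close>

text \<open>Basic weak-star neighbourhoods are given by finitely many vectors. Cluster points
  replace subsequential limits because dual balls are weak-star compact but in general not
  sequentially so.\<close>

definition weak_star_cluster :: "(nat \<Rightarrow> 'a::real_normed_vector \<Rightarrow>\<^sub>L real) \<Rightarrow> ('a \<Rightarrow>\<^sub>L real) \<Rightarrow> bool" where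
  "weak_star_cluster f g \<longleftrightarrow>
     (\<forall>X e N. finite X \<longrightarrow> 0 < e \<longrightarrow> (\<exists>n\<ge>N. \<forall>x\<in>X. \<bar>blinfun_apply (f n) x - blinfun_apply g x\<bar> < e))"

lemma weak_star_clusterD:
  assumes "weak_star_cluster f g" "finite X" "0 < e"
  shows "\<exists>n\<ge>N. \<forall>x\<in>X. \<bar>blinfun_apply (f n) x - blinfun_apply g x\<bar> < e"
  using assms unfolding weak_star_cluster_def by blast

text \<open>Banach-Alaoglu: the functionals lie in a product of compact intervals, which is compact
  by Tychonoff. A cluster point in this product is linear, since each linear relation involves only
  finitely many coordinates.\<close>

lemma ex_weak_star_cluster:
  fixes f :: "nat \<Rightarrow> 'a::real_normed_vector \<Rightarrow>\<^sub>L real"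
  assumes "bounded (range f)"
  obtains g where "weak_star_cluster f g"
proof -
  obtain M where M: "\<And>n. norm (f n) \<le> M"
    using assms by (auto simp: bounded_iff)
  define K where "K = PiE UNIV (\<lambda>x::'a. {- (M * norm x)..M * norm x})"
  have "compactin (product_topology (\<lambda>_. euclideanreal) (UNIV :: 'a set)) K"
    unfolding K_def compactin_PiE by auto
  then have "compact K"
    by (simp only: euclidean_product_topology compactin_euclidean_iff)
  define F where "F = filtermap (\<lambda>n. blinfun_apply (f n)) sequentially"
  have "blinfun_apply (f n) \<in> K" for n
  proof -
    have "\<bar>blinfun_apply (f n) x\<bar> \<le> M * norm x" for x
      using norm_blinfun[of "f n" x] mult_right_mono[OF M[of n], of "norm x"] by simp
    then show ?thesis unfolding K_def by (auto simp: abs_le_iff minus_le_iff)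
  qed
  then have "F \<le> principal K"
    by (simp add: F_def le_principal eventually_filtermap)
  moreover have "F \<noteq> bot" by (simp add: F_def filtermap_bot_iff)
  ultimately obtain g where g: "g \<in> K" "inf (nhds g) F \<noteq> bot"
    using \<open>compact K\<close> unfolding compact_filter le_principal by blast
  have near: "\<exists>n\<ge>N. \<forall>x\<in>X. \<bar>blinfun_apply (f n) x - g x\<bar> < e"
    if "finite X" "0 < e" for X e and N :: nat
  proof (rule ccontr)
    assume none: "\<not> ?thesis"
    define U where "U = (\<Inter>x\<in>X. {h :: 'a \<Rightarrow> real. \<bar>h x - g x\<bar> < e})"
    have "open U"
      unfolding U_def using that(1)
      by (intro open_INT ballI open_Collect_less continuous_intros) auto
    moreover have "g \<in> U" using that(2) by (simp add: U_def)
    ultimately have "\<forall>\<^sub>F h in nhds g. h \<in> U" by (rule eventually_nhds_in_open)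
    moreover have "\<forall>\<^sub>F h in F. h \<notin> U"
      unfolding F_def eventually_filtermap eventually_sequentially
      using none by (auto simp: U_def)
    ultimately have "\<forall>\<^sub>F h in inf (nhds g) F. False"
      unfolding eventually_inf by blast
    then show False using g(2) by (simp add: eventually_False)
  qed
  have g_bound: "\<bar>g x\<bar> \<le> M * norm x" for x
    using g(1) by (auto simp: K_def PiE_iff abs_le_iff minus_le_iff dest: spec[of _ x])
  have eq0: "t = 0" if "\<And>e. 0 < e \<Longrightarrow> \<bar>t\<bar> \<le> e" for t :: real
    using that by (metis abs_le_zero_iff field_le_epsilon add_0)
  have "g (x + y) - g x - g y = 0" for x y
  proof (rule eq0)
    fix e :: real assume "0 < e"
    then obtain n where n: "\<forall>z\<in>{x, y, x + y}. \<bar>blinfun_apply (f n) z - g z\<bar> < e / 3"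
      using near[of "{x, y, x + y}" "e / 3"] by auto
    then show "\<bar>g (x + y) - g x - g y\<bar> \<le> e"
      by (simp add: blinfun.add_right abs_if split: if_splits)
  qed
  moreover have "g (c *\<^sub>R x) - c * g x = 0" for c x
  proof (rule eq0)
    fix e :: real assume e: "0 < e"
    define d where "d = e / (1 + \<bar>c\<bar>)"
    have d: "0 < d" "d + \<bar>c\<bar> * d = e"
      using e by (simp_all add: d_def flip: distrib_left add_divide_distrib) (simp add: field_simps)
    obtain n where n: "\<forall>z\<in>{x, c *\<^sub>R x}. \<bar>blinfun_apply (f n) z - g z\<bar> < d"
      using near[of "{x, c *\<^sub>R x}" d] d by auto
    have "g (c *\<^sub>R x) - c * g x
        = c * (blinfun_apply (f n) x - g x) - (blinfun_apply (f n) (c *\<^sub>R x) - g (c *\<^sub>R x))"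
      by (simp add: blinfun.scaleR_right algebra_simps)
    then have "\<bar>g (c *\<^sub>R x) - c * g x\<bar>
        \<le> \<bar>c\<bar> * \<bar>blinfun_apply (f n) x - g x\<bar> + \<bar>blinfun_apply (f n) (c *\<^sub>R x) - g (c *\<^sub>R x)\<bar>"
      by (metis abs_mult abs_triangle_ineq4)
    also have "\<dots> \<le> \<bar>c\<bar> * d + d"
      using n by (intro add_mono mult_left_mono) auto
    finally show "\<bar>g (c *\<^sub>R x) - c * g x\<bar> \<le> e" using d by simp
  qed
  ultimately have "bounded_linear g"
    using g_bound by (intro bounded_linear_intro[of g M]) (simp_all add: algebra_simps)
  then have "weak_star_cluster f (Blinfun g)"
    using near by (simp add: weak_star_cluster_def bounded_linear_Blinfun_apply)
  then show thesis ..
qed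

text \<open>Diagonal choice: \<open>r i\<close> is taken so that \<open>f (r i)\<close> and
  \<open>g\<close> differ by less than \<open>1 / (i + 1)\<close> at
  \<open>c 0, ..., c i\<close>.\<close>

lemma weak_star_cluster_subseq:
  fixes c :: "nat \<Rightarrow> 'a::real_normed_vector"
  assumes "weak_star_cluster f g"
  obtains r where "strict_mono r"
    "\<And>l. (\<lambda>i. blinfun_apply (f (r i)) (c l)) \<longlonglongrightarrow> blinfun_apply g (c l)"
proof -
  let ?P = "\<lambda>i n. \<forall>l\<le>i. \<bar>blinfun_apply (f n) (c l) - blinfun_apply g (c l)\<bar> < inverse (real (Suc i))"
  have "\<exists>n\<ge>N. ?P i n" for i N
    using weak_star_clusterD[OF assms, of "c ` {..i}" "inverse (real (Suc i))" N]
    by (auto simp del: of_nat_Suc)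
  then have "\<exists>r. \<forall>i. ?P i (r i) \<and> r i < r (Suc i)"
    by (intro dependent_nat_choice) (use Suc_le_eq in metis)+
  then obtain r where r: "\<And>i. ?P i (r i)" "\<And>i. r i < r (Suc i)" by blast
  show thesis
  proof
    show "strict_mono r" using r(2) by (simp add: strict_mono_Suc_iff)
    show "(\<lambda>i. blinfun_apply (f (r i)) (c l)) \<longlonglongrightarrow> blinfun_apply g (c l)" for l
    proof (rule LIM_zero_cancel, rule Lim_null_comparison)
      show "\<forall>\<^sub>F i in sequentially. norm (blinfun_apply (f (r i)) (c l) - blinfun_apply g (c l))
          \<le> inverse (real (Suc i))"
        using r(1) by (intro eventually_sequentiallyI[of l]) (auto intro: less_imp_le)
    qed (rule LIMSEQ_inverse_real_of_nat)
  qed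
qed

lemma weak_star_cluster_unique:
  assumes "weak_star_cluster f g" "(\<lambda>i. blinfun_apply (f i) x) \<longlonglongrightarrow> l"
  shows "blinfun_apply g x = l"
proof (rule ccontr)
  assume "blinfun_apply g x \<noteq> l"
  then have e: "0 < \<bar>blinfun_apply g x - l\<bar> / 2" (is "0 < ?e") by simp
  from assms(2) e obtain N where N: "\<And>n. n \<ge> N \<Longrightarrow> \<bar>blinfun_apply (f n) x - l\<bar> < ?e"
    unfolding LIMSEQ_iff real_norm_def by blast
  obtain n where "n \<ge> N" "\<bar>blinfun_apply (f n) x - blinfun_apply g x\<bar> < ?e"
    using weak_star_clusterD[OF assms(1) _ e, of "{x}" N] by blast
  with N[OF \<open>n \<ge> N\<close>] show False by (simp add: abs_if split: if_splits)
qed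

lemma weak_star_cluster_ge:
  assumes "weak_star_cluster f g" "\<And>i. d \<le> blinfun_apply (f i) x"
  shows "d \<le> blinfun_apply g x"
proof (rule field_le_epsilon)
  fix e :: real assume e: "0 < e"
  obtain n where "\<bar>blinfun_apply (f n) x - blinfun_apply g x\<bar> < e"
    using weak_star_clusterD[OF assms(1) _ e, of "{x}" 0] by blast
  with assms(2)[of n] show "d \<le> blinfun_apply g x + e" by linarith
qed

subsection \<open>The represented dual\<close>

context
  fixes J :: "'d::banach_lattice \<Rightarrow> ('a::banach_lattice \<Rightarrow>\<^sub>L real)"
  assumes J: "dual_repr J"
begin

section \<open>Order and norm transported along \<open>J\<close>\<close>

lemma dual_repr_linear: "linear J" and dual_repr_norm: "norm (J a) = norm a"
  and dual_repr_bij: "bij J"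
  using J by (auto simp: dual_repr_def)

lemmas dual_repr_diff = linear_diff[OF dual_repr_linear]
  and dual_repr_minus = linear_neg[OF dual_repr_linear]
  and dual_repr_scaleR = linear_scale[OF dual_repr_linear]

lemma dual_repr_inv: "J (inv J f) = f"
  using dual_repr_bij by (simp add: bij_is_surj surj_f_inv_f)

lemma dual_repr_le_iff: "a \<le> b \<longleftrightarrow> (\<forall>x\<ge>0. blinfun_apply (J a) x \<le> blinfun_apply (J b) x)"
proof -
  have "a \<le> b \<longleftrightarrow> 0 \<le> b - a" by simp
  also have "\<dots> \<longleftrightarrow> (\<forall>x\<ge>0. 0 \<le> blinfun_apply (J (b - a)) x)"
    using J unfolding dual_repr_def by blast
  finally show ?thesis by (simp add: dual_repr_diff blinfun.diff_left)
qed

lemma dual_repr_leD: "a \<le> b \<Longrightarrow> 0 \<le> x \<Longrightarrow> blinfun_apply (J a) x \<le> blinfun_apply (J b) x"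
  by (simp add: dual_repr_le_iff)

lemma dual_repr_nonneg: "0 \<le> a \<Longrightarrow> 0 \<le> x \<Longrightarrow> 0 \<le> blinfun_apply (J a) x"
  using dual_repr_leD[of 0 a x] linear_0[OF dual_repr_linear] by simp

lemma dual_repr_mono: "0 \<le> a \<Longrightarrow> x \<le> y \<Longrightarrow> blinfun_apply (J a) x \<le> blinfun_apply (J a) y"
  using dual_repr_nonneg[of a "y - x"] by (simp add: blinfun.diff_right)

lemma dual_repr_bound: "\<bar>blinfun_apply (J a) x\<bar> \<le> norm a * norm x"
  using norm_blinfun[of "J a" x] by (simp add: dual_repr_norm)

lemma dual_repr_abs_le: "\<bar>blinfun_apply (J a) x\<bar> \<le> blinfun_apply (J (lat_abs a)) (lat_abs x)"
proof -
  have split: "x = pprt x - pprt (- x)"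
    using prts[of x] by (simp add: pprt_neg)
  have "lat_abs x = pprt x + pprt (- x)"
  proof -
    have "lat_abs x = x + sup 0 (- x - x)"
      unfolding lat_abs_def by (simp add: add_sup_distrib_left)
    moreover have "sup 0 (- x - x) = pprt (2 *\<^sub>R (- x))"
      by (simp add: pprt_def sup_commute scaleR_2)
    ultimately have "lat_abs x = x + 2 *\<^sub>R pprt (- x)"
      using scaleR_pprt[of 2 "- x"] by simp
    then show ?thesis using split by (metis add.assoc diff_add_cancel scaleR_2)
  qed
  moreover have "\<bar>blinfun_apply (J a) y\<bar> \<le> blinfun_apply (J (lat_abs a)) y" if "0 \<le> y" for y
    using dual_repr_leD[OF lat_abs_ge(1) that, of a] dual_repr_leD[OF lat_abs_ge(2) that, of a]
    by (simp add: dual_repr_minus blinfun.minus_left)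
  from this[of "pprt x"] this[of "pprt (- x)"]
  have "\<bar>blinfun_apply (J a) (pprt x - pprt (- x))\<bar> \<le> blinfun_apply (J (lat_abs a)) (pprt x + pprt (- x))"
    by (simp add: blinfun.diff_right blinfun.add_right)
  ultimately show ?thesis using split by simp
qed

text \<open>The limit is the value at \<open>x\<close> of the component of \<open>a\<close> carried by the band generated by \<open>u\<close>.\<close>
lemma dual_repr_carrier:
  assumes a: "0 \<le> a" and u: "0 \<le> u"
  obtains q where "\<And>x. 0 \<le> x \<Longrightarrow>
    (\<lambda>n. blinfun_apply (J a) (inf x (real n *\<^sub>R u))) \<longlonglongrightarrow> blinfun_apply (J q) x"
proof -
  let ?A = "\<lambda>x n. blinfun_apply (J a) (inf x (real n *\<^sub>R u))"
  have mono: "real n *\<^sub>R u \<le> t *\<^sub>R u" if "real n \<le> t" for n t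
    using that u by (rule scaleR_right_mono)
  have inc: "incseq (?A x)" for x
    by (intro incseq_SucI dual_repr_mono[OF a] inf_mono mono) auto
  have bnd: "?A x n \<le> blinfun_apply (J a) x" for x n
    by (intro dual_repr_mono[OF a]) simp
  have "\<exists>L. ?A x \<longlonglongrightarrow> L \<and> (\<forall>n. ?A x n \<le> L)" for x
    using incseq_convergent[OF inc] bnd by metis
  then obtain L where L: "\<And>x. ?A x \<longlonglongrightarrow> L x" "\<And>x n. ?A x n \<le> L x"
    by metis
  have nonneg: "0 \<le> real n *\<^sub>R u" for n using u by (simp add: scaleR_nonneg_nonneg)
  \<comment> \<open>Applied with \<open>1 / c\<close> to \<open>c *\<^sub>R x\<close>, this
    inequality also yields the reverse one.\<close>
  have L_scale: "L (c *\<^sub>R x) \<le> c * L x" if "0 < c" "0 \<le> x" for c x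
  proof (rule LIMSEQ_le_const2[OF L(1)], intro exI allI impI)
    fix n
    obtain N where N: "real n / c \<le> real N" using real_arch_simple by blast
    have "inf (c *\<^sub>R x) (real n *\<^sub>R u) \<le> inf (c *\<^sub>R x) (c *\<^sub>R (real N *\<^sub>R u))"
      using N that mono[of n "c * real N"] by (intro inf_mono) (auto simp: field_simps)
    also have "\<dots> = c *\<^sub>R inf x (real N *\<^sub>R u)"
      using that by (simp add: scaleR_inf_distrib)
    finally have "?A (c *\<^sub>R x) n \<le> blinfun_apply (J a) (c *\<^sub>R inf x (real N *\<^sub>R u))"
      by (intro dual_repr_mono[OF a])
    also have "\<dots> \<le> c * L x"
      using L(2)[of x N] that by (simp add: blinfun.scaleR_right)
    finally show "?A (c *\<^sub>R x) n \<le> c * L x" .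
  qed
  obtain q :: "'a \<Rightarrow>\<^sub>L real" where q: "\<And>x. 0 \<le> x \<Longrightarrow> blinfun_apply q x = L x"
  proof (rule extend_from_cone[where q = L and M = "norm a"])
    fix x y :: 'a assume x: "0 \<le> x" and y: "0 \<le> y"
    show "L (x + y) = L x + L y"
    proof (rule order.antisym)
      show "L (x + y) \<le> L x + L y"
      proof (rule LIMSEQ_le[OF L(1) tendsto_add[OF L(1) L(1)]], intro exI allI impI)
        fix n
        have "inf (x + y) (real n *\<^sub>R u) \<le> inf x (real n *\<^sub>R u) + inf y (real n *\<^sub>R u)"
          using inf_add_le[OF nonneg x y, of n] by (simp add: inf_commute)
        from dual_repr_mono[OF a this] show "?A (x + y) n \<le> ?A x n + ?A y n"
          by (simp add: blinfun.add_right)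
      qed
      \<comment> \<open>The two truncations at \<open>n\<close> times \<open>u\<close> add up to an
        element below \<open>x + y\<close> truncated at \<open>2 * n\<close> times \<open>u\<close>;
        the even-indexed terms have the same limit.\<close>
      have "(?A (x + y) \<circ> (\<lambda>n. 2 * n)) \<longlonglongrightarrow> L (x + y)"
        by (intro LIMSEQ_subseq_LIMSEQ[OF L(1)]) (simp add: strict_mono_def)
      then show "L x + L y \<le> L (x + y)"
      proof (rule LIMSEQ_le[OF tendsto_add[OF L(1) L(1)]], intro exI allI impI)
        fix n
        have "inf x (real n *\<^sub>R u) + inf y (real n *\<^sub>R u) \<le> inf (x + y) (real n *\<^sub>R u + real n *\<^sub>R u)"
          by (intro le_infI add_mono) simp_all
        also have "real n *\<^sub>R u + real n *\<^sub>R u = real (2 * n) *\<^sub>R u"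
          by (simp flip: scaleR_add_left)
        finally show "?A x n + ?A y n \<le> (?A (x + y) \<circ> (\<lambda>n. 2 * n)) n"
          using dual_repr_mono[OF a] by (simp add: blinfun.add_right[symmetric])
      qed
    qed
  next
    fix c :: real and x :: 'a assume c: "0 < c" and x: "0 \<le> x"
    have "L x \<le> (1 / c) * L (c *\<^sub>R x)"
      using L_scale[of "1 / c" "c *\<^sub>R x"] c x by (simp add: scaleR_nonneg_nonneg)
    then show "L (c *\<^sub>R x) = c * L x"
      using L_scale[OF c x] c by (simp add: field_simps)
  next
    fix x :: 'a assume x: "0 \<le> x"
    have "0 \<le> ?A x 0" using x by (simp add: inf_absorb2)
    then have "0 \<le> L x" using L(2)[of x 0] by simp
    moreover have "L x \<le> blinfun_apply (J a) x"
      by (rule LIMSEQ_le_const2[OF L(1)]) (use bnd in blast)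
    ultimately show "\<bar>L x\<bar> \<le> norm a * norm x"
      using dual_repr_bound[of a x] by simp
  qed blast
  show thesis
  proof
    show "?A x \<longlonglongrightarrow> blinfun_apply (J (inv J q)) x" if "0 \<le> x" for x
      using L(1)[of x] q[OF that] by (simp add: dual_repr_inv)
  qed
qed

end

text \<open>No supremum of the sequence has to exist: the differences between upper bounds and terms
  form a downward directed set with infimum 0, so some difference \<open>c - q N\<close> has small
  norm, and it dominates \<open>q m - q N\<close>.\<close>

lemma order_continuous_increasing_Cauchy:
  fixes q :: "nat \<Rightarrow> 'a::banach_lattice"
  assumes oc: "order_continuous TYPE('a)"
    and inc: "\<And>n. q n \<le> q (Suc n)" and bnd: "\<And>n. q n \<le> b" and e: "0 < e"
  obtains N where "\<And>m. m \<ge> N \<Longrightarrow> norm (q m - q N) < e"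
proof -
  have mono: "q m \<le> q n" if "m \<le> n" for m n
    using lift_Suc_mono_le[of q, OF inc that] .
  define D where "D = {c - q n | c n. \<forall>m. q m \<le> c}"
  have "\<exists>x\<in>D. norm x < e"
  proof (rule oc[unfolded order_continuous_def, rule_format])
    have "b - q 0 \<in> D" using bnd by (auto simp: D_def)
    moreover have "\<exists>z\<in>D. z \<le> x \<and> z \<le> y" if xy: "x \<in> D" "y \<in> D" for x y
    proof -
      from xy obtain c n d k where *: "x = c - q n" "y = d - q k" "\<forall>m. q m \<le> c" "\<forall>m. q m \<le> d"
        by (auto simp: D_def)
      then have "inf c d - q (max n k) \<in> D" by (auto simp: D_def)
      moreover have "inf c d - q (max n k) \<le> x" "inf c d - q (max n k) \<le> y"
        using * mono by (auto intro!: diff_mono)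
      ultimately show ?thesis by blast
    qed
    moreover have "0 \<le> x" if "x \<in> D" for x using that by (auto simp: D_def)
    moreover have "w \<le> 0" if w: "\<forall>x\<in>D. w \<le> x" for w
    proof (rule archimedean_le_0)
      \<comment> \<open>Subtracting a lower bound \<open>w\<close> of \<open>D\<close> from an upper
        bound of the sequence gives an upper bound again, so this can be repeated \<open>k\<close>
        times.\<close>
      have ub: "\<forall>m. q m \<le> b - real k *\<^sub>R w" for k
      proof (induction k)
        case (Suc k)
        have "w \<le> (b - real k *\<^sub>R w) - q m" for m using w Suc by (auto simp: D_def)
        then show ?case by (auto simp: algebra_simps)
      qed (simp add: bnd)
      then have "q 0 \<le> b - real k *\<^sub>R w" for k by blast
      then show "real k *\<^sub>R w \<le> b - q 0" for k by (simp add: algebra_simps)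
    qed
    ultimately show "D \<noteq> {} \<and> (\<forall>x\<in>D. \<forall>y\<in>D. \<exists>z\<in>D. z \<le> x \<and> z \<le> y) \<and> (\<forall>x\<in>D. 0 \<le> x)
        \<and> (\<forall>w. (\<forall>x\<in>D. w \<le> x) \<longrightarrow> w \<le> 0)"
      by blast
  qed (rule e)
  then obtain c N where c: "\<forall>m. q m \<le> c" "norm (c - q N) < e" by (auto simp: D_def)
  show thesis
  proof
    show "norm (q m - q N) < e" if "m \<ge> N" for m
    proof (rule le_less_trans[OF _ c(2)], rule norm_mono_nonneg)
      show "0 \<le> q m - q N" using mono[OF that] by simp
      show "q m - q N \<le> c - q N" using c(1) by (simp add: diff_right_mono)
    qed
  qed
qed

subsection \<open>Order continuity of the dual\<close>

context
  fixes J :: "'d::banach_lattice \<Rightarrow> ('a::banach_lattice \<Rightarrow>\<^sub>L real)"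
  assumes J: "dual_repr J" and oc: "order_continuous TYPE('d)"
begin

text \<open>The carriers of the partial sums form an increasing sequence below \<open>a\<close>, hence a Cauchy
  sequence; but consecutive ones differ by \<open>J a (v N)\<close> at \<open>v N\<close>.\<close>
lemma bounded_disjoint_not_bounded_below:
  assumes a: "0 \<le> a" and v: "\<And>n::nat. 0 \<le> v n" and M: "\<And>n. norm (v n) \<le> M"
    and disj: "\<And>i j. i < j \<Longrightarrow> inf (v j) (v i) = 0"
    and h: "0 < h"
  shows "\<exists>n. blinfun_apply (J a) (v n) < h"
proof (rule ccontr)
  assume "\<not> ?thesis"
  then have low: "h \<le> blinfun_apply (J a) (v n)" for n by (simp add: not_less)
  define u where "u N = (\<Sum>i<N. v i)" for N :: nat
  have u: "0 \<le> u N" for N unfolding u_def by (intro sum_nonneg v)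
  have "\<exists>q. \<forall>x\<ge>0. (\<lambda>n. blinfun_apply (J a) (inf x (real n *\<^sub>R u N))) \<longlonglongrightarrow> blinfun_apply (J q) x" for N
    by (rule dual_repr_carrier[OF J a u[of N]]) blast
  then obtain q where q: "\<And>N x. 0 \<le> x \<Longrightarrow>
      (\<lambda>n. blinfun_apply (J a) (inf x (real n *\<^sub>R u N))) \<longlonglongrightarrow> blinfun_apply (J (q N)) x"
    by metis
  have "q N \<le> q (Suc N)" for N
    unfolding dual_repr_le_iff[OF J]
  proof (intro allI impI)
    fix x :: 'a assume x: "0 \<le> x"
    have "u N \<le> u (Suc N)" by (simp add: u_def v)
    then have "real n *\<^sub>R u N \<le> real n *\<^sub>R u (Suc N)" for n by (rule scaleR_left_mono) simp
    then show "blinfun_apply (J (q N)) x \<le> blinfun_apply (J (q (Suc N))) x"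
      by (intro LIMSEQ_le[OF q[OF x] q[OF x]] exI allI impI dual_repr_mono[OF J a] inf_mono order_refl)
  qed
  moreover have "q N \<le> a" for N
    unfolding dual_repr_le_iff[OF J]
  proof (intro allI impI)
    fix x :: 'a assume x: "0 \<le> x"
    show "blinfun_apply (J (q N)) x \<le> blinfun_apply (J a) x"
      by (intro LIMSEQ_le_const2[OF q[OF x]] exI allI impI dual_repr_mono[OF J a]) simp
  qed
  moreover have M0: "0 \<le> M" using M[of 0] norm_ge_zero[of "v 0"] by linarith
  \<comment> \<open>This margin times the norm bound \<open>M\<close> stays below \<open>h\<close>,
    which gives the contradiction at \<open>v N\<close>.\<close>
  moreover have "0 < h / (M + 1)" using h M0 by simp
  ultimately obtain N where N: "\<And>m. m \<ge> N \<Longrightarrow> norm (q m - q N) < h / (M + 1)"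
    using order_continuous_increasing_Cauchy[OF oc, of q a "h / (M + 1)"] by blast
  \<comment> \<open>Disjointness of \<open>v N\<close> from \<open>u N\<close> makes
    \<open>J (q N)\<close> vanish at \<open>v N\<close>.\<close>
  have disj_sum: "inf (v N) (\<Sum>i<k. v i) = 0" if "k \<le> N" for k
    using that
  proof (induction k)
    case (Suc k)
    have "inf (v N) ((\<Sum>i<k. v i) + v k) \<le> inf (v N) (\<Sum>i<k. v i) + inf (v N) (v k)"
      by (intro inf_add_le v sum_nonneg)
    also have "\<dots> = 0" using Suc disj[of k N] by simp
    finally show ?case using v by (intro order.antisym) (auto intro!: sum_nonneg add_nonneg_nonneg)
  qed (simp add: inf_absorb2 v)
  have "inf (v N) (real n *\<^sub>R u N) = 0" for n
    using disj_sum[OF order_refl] inf_eq_0_scaleR[of "v N" "u N" "real n"] v[of N]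
    by (cases "n = 0") (simp_all add: u_def inf_absorb2)
  then have "(\<lambda>n. 0) \<longlonglongrightarrow> blinfun_apply (J (q N)) (v N)"
    using q[OF v, of N N] by simp
  then have 0: "blinfun_apply (J (q N)) (v N) = 0"
    by (simp add: LIMSEQ_const_iff)
  \<comment> \<open>In contrast, \<open>u (Suc N)\<close> dominates \<open>v N\<close>, so
    truncation by its multiples loses nothing.\<close>
  have "blinfun_apply (J a) (v N) \<le> blinfun_apply (J (q (Suc N))) (v N)"
  proof (rule LIMSEQ_le_const[OF q[OF v]], intro exI allI impI)
    fix n :: nat assume n: "1 \<le> n"
    have "v N \<le> u (Suc N)" unfolding u_def using sum_nonneg[of "{..<N}" v] v by simp
    also have "u (Suc N) \<le> real n *\<^sub>R u (Suc N)"
      using scaleR_right_mono[of 1 "real n" "u (Suc N)"] n u by simp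
    finally show "blinfun_apply (J a) (v N) \<le> blinfun_apply (J a) (inf (v N) (real n *\<^sub>R u (Suc N)))"
      by (simp add: inf_absorb1)
  qed
  then have "h \<le> blinfun_apply (J (q (Suc N) - q N)) (v N)"
    using low[of N] 0 by (simp add: dual_repr_diff[OF J] blinfun.diff_left)
  also have "\<dots> \<le> norm (q (Suc N) - q N) * norm (v N)"
    using dual_repr_bound[OF J, of "q (Suc N) - q N" "v N"] by simp
  also have "\<dots> \<le> h / (M + 1) * M"
    using N[of "Suc N"] M[of N] M0 h by (intro mult_mono) auto
  also have "\<dots> < h" using h M0 by (simp add: field_simps)
  finally show False by simp
qed

text \<open>Otherwise terms \<open>y n\<close> with value at least \<open>h\<close> can be chosen
  that are almost disjoint, as seen by \<open>J a\<close>, from multiples of the sum of the earlier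
  ones. Subtracting suitable vectors and taking positive parts makes them exactly disjoint, with
  values still at least \<open>h / 2\<close>, against the preceding lemma.\<close>

lemma truncations_null_imp_null:
  assumes a: "0 \<le> a" and w: "\<And>n::nat. 0 \<le> w n" and M: "\<And>n. norm (w n) \<le> M"
    and trunc: "\<And>u. 0 \<le> u \<Longrightarrow> (\<lambda>n. blinfun_apply (J a) (inf (w n) u)) \<longlonglongrightarrow> 0"
  shows "(\<lambda>n. blinfun_apply (J a) (w n)) \<longlonglongrightarrow> 0"
proof (rule ccontr)
  assume "\<not> ?thesis"
  then obtain h where h: "0 < h" "\<And>N. \<exists>n\<ge>N. h \<le> \<bar>blinfun_apply (J a) (w n)\<bar>"
    unfolding LIMSEQ_iff by (auto simp: not_less)
  have big: "\<exists>n\<ge>N. h \<le> blinfun_apply (J a) (w n)" for N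
    using h(2)[of N] dual_repr_nonneg[OF J a w] by (metis abs_of_nonneg)
  have M0: "0 \<le> M" using M[of 0] norm_ge_zero[of "w 0"] by linarith
  \<comment> \<open>Chosen so that \<open>J a\<close> is at most \<open>h / 4\<close> at
    \<open>\<theta> *\<^sub>R W\<close>, where \<open>norm W \<le> 2 * M\<close>; the summand 1
    keeps the denominator positive.\<close>
  define \<theta> where "\<theta> = h / (4 * (2 * norm a * M + 1))"
  have \<theta>: "0 < \<theta>" "\<theta> * (norm a * (2 * M)) \<le> h / 4"
  proof -
    define K where "K = norm a * (2 * M)"
    have K: "0 \<le> K" using M0 by (simp add: K_def)
    have \<theta>_eq: "\<theta> = h / (4 * (K + 1))" by (simp add: \<theta>_def K_def ac_simps)
    show "0 < \<theta>" using h K by (simp add: \<theta>_eq)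
    have "K / (K + 1) * (h / 4) \<le> 1 * (h / 4)"
      using h K by (intro mult_right_mono) auto
    then show "\<theta> * (norm a * (2 * M)) \<le> h / 4"
      unfolding K_def[symmetric] by (simp add: \<theta>_eq field_simps)
  qed
  \<comment> \<open>\<open>C n\<close> is the inverse of \<open>\<theta> * (1/2) ^ n\<close>, the
    weight with which \<open>y n\<close> enters \<open>\<theta> *\<^sub>R W\<close>.\<close>
  define C where "C n = 2 ^ n / \<theta>" for n :: nat
  have C: "0 < C n" for n using \<theta> by (simp add: C_def)
  \<comment> \<open>The state holds the index chosen last and the sum of all terms chosen so far.
    The start has sum 0 and a dummy index.\<close>
  have "\<exists>x. \<forall>n. ((n = 0 \<longrightarrow> snd (x n) = 0) \<and> 0 \<le> snd (x n)) \<and>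
      (h \<le> blinfun_apply (J a) (w (fst (x (Suc n))))
        \<and> blinfun_apply (J a) (inf (w (fst (x (Suc n)))) (C n *\<^sub>R snd (x n))) \<le> h / 4
        \<and> snd (x (Suc n)) = snd (x n) + w (fst (x (Suc n))))" (is "\<exists>x. \<forall>n. ?P n (x n) \<and> ?Q n (x n) (x (Suc n))")
  proof (rule dependent_nat_choice)
    show "\<exists>x. ?P 0 x" by (rule exI[of _ "(0, 0)"]) simp
  next
    fix x n assume P: "?P n x"
    have "0 \<le> C n *\<^sub>R snd x" using P C[of n] by (simp add: scaleR_nonneg_nonneg)
    then have "\<forall>\<^sub>F k in sequentially. blinfun_apply (J a) (inf (w k) (C n *\<^sub>R snd x)) < h / 4"
      using h(1) by (intro order_tendstoD(2)[OF trunc]) auto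
    then obtain k where k: "h \<le> blinfun_apply (J a) (w k)"
        "blinfun_apply (J a) (inf (w k) (C n *\<^sub>R snd x)) < h / 4"
      using big unfolding eventually_sequentially by blast
    show "\<exists>y. ?P (Suc n) y \<and> ?Q n x y"
      by (rule exI[of _ "(k, snd x + w k)"]) (use k P w in \<open>simp add: add_nonneg_nonneg\<close>)
  qed
  then obtain x where x: "\<And>n. ?P n (x n)" "\<And>n. ?Q n (x n) (x (Suc n))" by blast
  define y where "y n = w (fst (x (Suc n)))" for n
  have y: "0 \<le> y n" "norm (y n) \<le> M" for n using w M by (auto simp: y_def)
  have S: "snd (x n) = (\<Sum>i<n. y i)" for n
  proof (induction n)
    case 0 then show ?case using x(1)[of 0] by simp
  next
    case (Suc n) then show ?case using x(2)[of n] by (simp add: y_def)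
  qed
  have y_big: "h \<le> blinfun_apply (J a) (y n)"
    and y_small: "blinfun_apply (J a) (inf (y n) (C n *\<^sub>R (\<Sum>i<n. y i))) \<le> h / 4" for n
    using x(2)[of n] by (simp_all add: y_def S[unfolded y_def])
  define f where "f n = (1/2) ^ n *\<^sub>R y n" for n
  have f: "0 \<le> f n" for n using y by (simp add: f_def scaleR_nonneg_nonneg)
  have norm_f: "norm (f n) \<le> (1/2) ^ n * M" for n
    using y[of n] by (simp add: f_def mult_left_mono)
  have geo: "summable (\<lambda>n. (1/2) ^ n * M)" "(\<Sum>n. (1/2) ^ n * M) = 2 * M"
    using suminf_geometric[of "1/2 :: real"] by (auto simp: summable_mult2 simp flip: suminf_mult2)
  have sum_norm: "summable (\<lambda>n. norm (f n))"
    by (rule summable_comparison_test'[OF geo(1)]) (use norm_f in simp)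
  then have "summable f" by (rule summable_norm_cancel)
  define W where "W = suminf f"
  have fW: "f n \<le> W" for n unfolding W_def by (rule le_suminf_nonneg[OF \<open>summable f\<close> f])
  have W0: "0 \<le> W" using f[of 0] fW[of 0] by (rule order_trans)
  have "norm W \<le> 2 * M"
    unfolding W_def geo(2)[symmetric]
    by (rule order_trans[OF summable_norm[OF sum_norm] suminf_le[OF norm_f sum_norm geo(1)]])
  then have "blinfun_apply (J a) W \<le> norm a * (2 * M)"
    using dual_repr_bound[OF J, of a W] mult_left_mono[of "norm W" "2 * M" "norm a"] by simp
  then have W_small: "blinfun_apply (J a) (\<theta> *\<^sub>R W) \<le> h / 4"
  proof -
    have "\<theta> * blinfun_apply (J a) W \<le> \<theta> * (norm a * (2 * M))"
      using \<open>blinfun_apply (J a) W \<le> _\<close> \<theta>(1) by (intro mult_left_mono) auto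
    also have "\<dots> \<le> h / 4" by (rule \<theta>(2))
    finally show ?thesis by (simp add: blinfun.scaleR_right)
  qed
  \<comment> \<open>The multiple of the earlier sum separates \<open>v n\<close> from earlier terms,
    the multiple of \<open>W\<close> from later ones.\<close>
  define v where "v n = pprt (y n - (C n *\<^sub>R (\<Sum>i<n. y i) + \<theta> *\<^sub>R W))" for n
  have sub0: "0 \<le> C n *\<^sub>R (\<Sum>i<n. y i)" "0 \<le> \<theta> *\<^sub>R W" for n
    using C[of n] y W0 \<theta> by (simp_all add: scaleR_nonneg_nonneg sum_nonneg)
  have v: "0 \<le> v n" "norm (v n) \<le> M" for n
  proof -
    show "0 \<le> v n" by (simp add: v_def)
    have "v n \<le> y n" unfolding v_def by (intro pprt_diff_le add_nonneg_nonneg sub0 y)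
    then show "norm (v n) \<le> M" using norm_mono_nonneg[of "v n" "y n"] \<open>0 \<le> v n\<close> y(2)[of n] by simp
  qed
  have disj: "inf (v j) (v i) = 0" if "i < j" for i j
  proof -
    have "C j *\<^sub>R y i \<le> C j *\<^sub>R (\<Sum>i<j. y i)"
    proof (rule scaleR_left_mono)
      have "(\<Sum>i<j. y i) = y i + sum y ({..<j} - {i})" using that by (intro sum.remove) auto
      then show "y i \<le> (\<Sum>i<j. y i)" using sum_nonneg[of "{..<j} - {i}" y] y by simp
    qed (use C[of j] in simp)
    then have 1: "v j \<le> pprt (y j - C j *\<^sub>R y i)"
      unfolding v_def using sub0(2) by (intro pprt_mono diff_left_mono) (simp add: add_increasing2)
    have "\<theta> *\<^sub>R f j \<le> \<theta> *\<^sub>R W" using \<theta> by (intro scaleR_left_mono fW) simp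
    then have 2: "v i \<le> pprt (y i - \<theta> *\<^sub>R f j)"
      unfolding v_def using sub0(1) by (intro pprt_mono diff_left_mono) (simp add: add_increasing)
    \<comment> \<open>With \<open>c * C j = 1\<close>, the bounds for \<open>v j\<close> and
      \<open>v i\<close> become, up to the factor \<open>c\<close>, the positive parts of a vector
      and of its negative, hence disjoint.\<close>
    define c where "c = \<theta> * (1/2) ^ j"
    have c: "0 < c" "c * C j = 1"
      using \<theta> by (simp_all add: c_def C_def power_one_over)
    have "y i - \<theta> *\<^sub>R f j = c *\<^sub>R (- (y j - C j *\<^sub>R y i))"
      using c(2) by (simp add: f_def c_def[symmetric] scaleR_diff_right)
    then have "v i \<le> c *\<^sub>R pprt (- (y j - C j *\<^sub>R y i))"
      using 2 scaleR_pprt[OF c(1)] by metis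
    with 1 have "inf (v j) (v i)
        \<le> inf (pprt (y j - C j *\<^sub>R y i)) (c *\<^sub>R pprt (- (y j - C j *\<^sub>R y i)))"
      by (rule inf_mono)
    also have "\<dots> = 0" by (intro inf_eq_0_scaleR inf_pprt_uminus c)
    finally show ?thesis using v(1) by (intro order.antisym) auto
  qed
  have "h / 2 \<le> blinfun_apply (J a) (v n)" for n
  proof -
    \<comment> \<open>The part removed from \<open>y n\<close> splits into two pieces, each costing
      at most \<open>h / 4\<close>.\<close>
    have "y n - v n = inf (y n) (C n *\<^sub>R (\<Sum>i<n. y i) + \<theta> *\<^sub>R W)"
      unfolding v_def by (rule diff_pprt_diff)
    also have "\<dots> \<le> inf (y n) (C n *\<^sub>R (\<Sum>i<n. y i)) + inf (y n) (\<theta> *\<^sub>R W)"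
      by (intro inf_add_le y sub0)
    also have "\<dots> \<le> inf (y n) (C n *\<^sub>R (\<Sum>i<n. y i)) + \<theta> *\<^sub>R W"
      by (intro add_left_mono inf_le2)
    finally have "blinfun_apply (J a) (y n - v n)
        \<le> blinfun_apply (J a) (inf (y n) (C n *\<^sub>R (\<Sum>i<n. y i)) + \<theta> *\<^sub>R W)"
      by (rule dual_repr_mono[OF J a])
    then show ?thesis
      using y_big[of n] y_small[of n] W_small by (simp add: blinfun.diff_right blinfun.add_right)
  qed
  moreover have "\<exists>n. blinfun_apply (J a) (v n) < h / 2"
    using h(1) by (intro bounded_disjoint_not_bounded_below[OF a v disj]) simp_all
  ultimately show False by (auto simp flip: not_less)
qed

text \<open>The modulus of the functional, evaluated at \<open>lat_abs (y n - l)\<close>, dominates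
  the difference; its truncations tend to 0 by assumption, and boundedness removes the
  truncation.\<close>

lemma uaw_imp_weak:
  fixes f :: "'a \<Rightarrow>\<^sub>L real"
  assumes bnd: "bounded (range y)" and uaw: "uaw_convergent_to y l"
  shows "(\<lambda>n. blinfun_apply f (y n)) \<longlonglongrightarrow> blinfun_apply f l"
proof -
  define a where "a = inv J f"
  have f: "f = J a" by (simp add: a_def dual_repr_inv[OF J])
  obtain M where M: "\<And>n. norm (y n) \<le> M" using bnd by (auto simp: bounded_iff)
  have "norm (lat_abs (y n - l)) \<le> M + norm l" for n
    using norm_triangle_ineq4[of "y n" l] M[of n] by simp
  moreover have "(\<lambda>n. blinfun_apply (J (lat_abs a)) (inf (lat_abs (y n - l)) u)) \<longlonglongrightarrow> 0" if "0 \<le> u" for u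
    using uaw that unfolding uaw_convergent_to_def by blast
  ultimately have "(\<lambda>n. blinfun_apply (J (lat_abs a)) (lat_abs (y n - l))) \<longlonglongrightarrow> 0"
    by (intro truncations_null_imp_null[of "lat_abs a" "\<lambda>n. lat_abs (y n - l)" "M + norm l"] lat_abs_ge(3))
  then have "(\<lambda>n. blinfun_apply f (y n - l)) \<longlonglongrightarrow> 0"
    by (rule Lim_null_comparison[rotated]) (simp add: f dual_repr_abs_le[OF J])
  then show ?thesis by (simp add: blinfun.diff_right LIM_zero_iff)
qed

end

subsection \<open>Lattice operations in the dual of an AL-space\<close>

text \<open>Riesz-Kantorovich formula: \<open>F p\<close> is the supremum of \<open>\<phi>\<close>
  over the order interval from 0 to \<open>p\<close>.\<close>

lemma positive_part_functional:
  fixes \<phi> :: "'d::banach_lattice \<Rightarrow>\<^sub>L real"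
  obtains F :: "'d \<Rightarrow> real" where
    "\<And>x y. 0 \<le> x \<Longrightarrow> 0 \<le> y \<Longrightarrow> F (x + y) = F x + F y"
    "\<And>x. 0 \<le> x \<Longrightarrow> 0 \<le> F x" "\<And>x. 0 \<le> x \<Longrightarrow> blinfun_apply \<phi> x \<le> F x"
proof -
  define F where "F p = (SUP q\<in>{0..p}. blinfun_apply \<phi> q)" for p
  have bdd: "bdd_above (blinfun_apply \<phi> ` {0..p})" for p
  proof (rule bdd_aboveI2)
    fix q assume "q \<in> {0..p}"
    then have "norm q \<le> norm p" by (intro norm_mono_nonneg) auto
    then show "blinfun_apply \<phi> q \<le> norm \<phi> * norm p"
      using norm_blinfun[of \<phi> q] mult_left_mono[of "norm q" "norm p" "norm \<phi>"] by simp
  qed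
  have upper: "blinfun_apply \<phi> q \<le> F p" if "0 \<le> q" "q \<le> p" for p q
    unfolding F_def using that by (intro cSUP_upper bdd) auto
  have least: "F p \<le> c" if "0 \<le> p" "\<And>q. 0 \<le> q \<Longrightarrow> q \<le> p \<Longrightarrow> blinfun_apply \<phi> q \<le> c" for p c
    unfolding F_def using that by (intro cSUP_least) auto
  show thesis
  proof
    fix x y :: 'd assume x: "0 \<le> x" and y: "0 \<le> y"
    show "F (x + y) = F x + F y"
    proof (rule order.antisym)
      show "F (x + y) \<le> F x + F y"
      proof (rule least)
        fix q assume q: "0 \<le> q" "q \<le> x + y"
        \<comment> \<open>Riesz decomposition of \<open>q\<close> into a part below \<open>x\<close>
          and a part below \<open>y\<close>.\<close>
        have "q = inf q x + pprt (q - x)" using diff_pprt_diff[of q x] by (metis diff_add_cancel)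
        then have "blinfun_apply \<phi> q = blinfun_apply \<phi> (inf q x) + blinfun_apply \<phi> (pprt (q - x))"
          by (metis blinfun.add_right)
        also have "\<dots> \<le> F x + F y"
          using q x y by (intro add_mono upper) (auto simp: pprt_def algebra_simps)
        finally show "blinfun_apply \<phi> q \<le> F x + F y" .
      qed (use x y in simp)
      have "F x \<le> F (x + y) - F y"
      proof (rule least[OF x])
        fix q assume q: "0 \<le> q" "q \<le> x"
        have "F y \<le> F (x + y) - blinfun_apply \<phi> q"
        proof (rule least[OF y])
          fix q' assume "0 \<le> q'" "q' \<le> y"
          then show "blinfun_apply \<phi> q' \<le> F (x + y) - blinfun_apply \<phi> q"
            using upper[of "q + q'" "x + y"] q by (simp add: add_mono blinfun.add_right)
        qed
        then show "blinfun_apply \<phi> q \<le> F (x + y) - F y" by simp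
      qed
      then show "F x + F y \<le> F (x + y)" by simp
    qed
    show "0 \<le> F x" using upper[of 0 x] x by simp
    show "blinfun_apply \<phi> x \<le> F x" using upper[of x x] x by simp
  qed
qed

section \<open>Finite suprema and infima, and the selection of signs\<close>

primrec sup_upto :: "(nat \<Rightarrow> 'a::lattice) \<Rightarrow> nat \<Rightarrow> 'a" where
  "sup_upto f 0 = f 0"
| "sup_upto f (Suc n) = sup (sup_upto f n) (f (Suc n))"

primrec inf_upto :: "(nat \<Rightarrow> 'a::lattice) \<Rightarrow> nat \<Rightarrow> 'a" where
  "inf_upto f 0 = f 0"
| "inf_upto f (Suc n) = inf (inf_upto f n) (f (Suc n))"

lemma sup_upto_upper: "i \<le> n \<Longrightarrow> f i \<le> sup_upto f n"
  by (induction n) (auto simp: le_Suc_eq intro: le_supI1)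

lemma sup_upto_least: "(\<And>i. i \<le> n \<Longrightarrow> f i \<le> c) \<Longrightarrow> sup_upto f n \<le> c"
  by (induction n) auto

lemma inf_upto_lower: "i \<le> n \<Longrightarrow> inf_upto f n \<le> f i"
  by (induction n) (auto simp: le_Suc_eq intro: le_infI1)

lemma inf_upto_greatest: "(\<And>i. i \<le> n \<Longrightarrow> c \<le> f i) \<Longrightarrow> c \<le> inf_upto f n"
  by (induction n) auto

lemma inf_sup_upto_le:
  fixes f :: "nat \<Rightarrow> 'a::lattice_ab_group_add"
  assumes "\<And>i. i \<le> n \<Longrightarrow> inf x (f i) \<le> r"
  shows "inf x (sup_upto f n) \<le> r"
  using assms by (induction n) (auto simp: inf_sup_distrib_lattice_group)

text \<open>A Fatou-type lemma for a merely finitely additive \<open>F\<close>. The suprema of long blocks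
  \<open>s j\<close> of the sequence have finite infima \<open>t m\<close> on which \<open>F\<close> stays above \<open>h / 2\<close>; distributing infima over suprema,
  a selection in the style of Koenig's lemma picks one term \<open>\<plusminus>g i\<close> from each block.\<close>
lemma select_signs:
  fixes g :: "nat \<Rightarrow> 'd::lattice_ab_group_add" and F :: "'d \<Rightarrow> real"
  assumes add: "\<And>x y. 0 \<le> x \<Longrightarrow> 0 \<le> y \<Longrightarrow> F (x + y) = F x + F y"
    and pos: "\<And>x. 0 \<le> x \<Longrightarrow> 0 \<le> F x"
    and bnd: "\<And>i. lat_abs (g i) \<le> b"
    and h: "0 < h" "\<And>i. h \<le> F (lat_abs (g i))"
    and r: "0 \<le> r" "F r < h / 2"
  shows "\<exists>opt a. (\<forall>n. \<exists>i\<ge>n. opt n = g i \<or> opt n = - g i)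
    \<and> (\<forall>n::nat. \<forall>j<n. a n \<le> opt j) \<and> (\<forall>n. \<not> a n \<le> r)"
proof -
  have mono: "F x \<le> F y" if "0 \<le> x" "x \<le> y" for x y
    using add[of x "y - x"] pos[of "y - x"] that by simp
  have modular: "F (inf x y) = F x + F y - F (sup x y)" if "0 \<le> x" "0 \<le> y" for x y
    using add[of x y] add[of "sup x y" "inf x y"] that
    by (simp add: le_supI1 flip: add_eq_inf_sup)
  define p where "p i = lat_abs (g i)" for i
  have p: "0 \<le> p i" "h \<le> F (p i)" "p i \<le> b" for i using h bnd by (simp_all add: p_def lat_abs_ge)
  define S where "S j m = sup_upto (\<lambda>i. p (j + i)) m" for j m
  have p_S: "p i \<le> S j m" if "j \<le> i" "i \<le> j + m" for i j m
    using sup_upto_upper[of "i - j" m "\<lambda>i. p (j + i)"] that by (simp add: S_def)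
  have S0: "0 \<le> S j m" for j m using p(1)[of j] p_S[of j j m] by simp
  \<comment> \<open>The errors sum to \<open>h / 2\<close>; the first \<open>m\<close> of them sum
    to \<open>h / 2 * (1 - (1/2) ^ m)\<close>.\<close>
  define \<eta> where "\<eta> j = h / 4 * (1/2) ^ j" for j :: nat
  have \<eta>: "0 < \<eta> j" for j using h by (simp add: \<eta>_def)
  \<comment> \<open>The block starting at \<open>j\<close> is made so long that lengthening it
    raises \<open>F\<close> by at most \<open>\<eta> j\<close>.\<close>
  have "\<exists>m. \<forall>m'. F (S j m') \<le> F (S j m) + \<eta> j" for j
  proof -
    have bdd: "bdd_above (range (\<lambda>m. F (S j m)))"
      by (intro bdd_aboveI2[of _ _ "F b"] mono S0) (auto simp: S_def intro: sup_upto_least p)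
    have "(SUP m. F (S j m)) - \<eta> j < (SUP m. F (S j m))" using \<eta>[of j] by simp
    then obtain m where m: "(SUP m. F (S j m)) - \<eta> j < F (S j m)"
      using less_cSUP_iff[OF _ bdd] by auto
    have "F (S j m') \<le> F (S j m) + \<eta> j" for m'
      using cSUP_upper[OF _ bdd, of m'] m by simp
    then show ?thesis by blast
  qed
  then obtain \<mu> where \<mu>: "\<And>j m'. F (S j m') \<le> F (S j (\<mu> j)) + \<eta> j" by metis
  define s where "s j = S j (\<mu> j)" for j
  define t where "t = inf_upto s"
  have s0: "0 \<le> s j" for j by (simp add: s_def S0)
  have t0: "0 \<le> t m" for m unfolding t_def by (intro inf_upto_greatest s0)
  have t_anti: "t m \<le> t n" if "n \<le> m" for m n
    unfolding t_def using that by (intro inf_upto_greatest inf_upto_lower) simp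
  have F_t: "F (s m) - h / 2 * (1 - (1/2) ^ m) \<le> F (t m)" for m
  proof (induction m)
    case (Suc m)
    \<comment> \<open>A block from \<open>m\<close> of this length covers the blocks
      \<open>s m\<close> and \<open>s (Suc m)\<close>; the latter starts one place later, hence the
      \<open>Suc\<close>. So \<open>sup (t m) (s (Suc m))\<close> exceeds \<open>s m\<close> by at
      most \<open>\<eta> m\<close> under \<open>F\<close>.\<close>
    define M where "M = max (\<mu> m) (Suc (\<mu> (Suc m)))"
    have "s m \<le> S m M" unfolding s_def[of m] S_def[of m "\<mu> m"]
      by (intro sup_upto_least p_S) (auto simp: M_def)
    moreover have "s (Suc m) \<le> S m M" unfolding s_def[of "Suc m"] S_def[of "Suc m"]
      by (intro sup_upto_least p_S) (auto simp: M_def)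
    moreover have "t m \<le> s m" unfolding t_def by (intro inf_upto_lower) simp
    ultimately have "F (sup (t m) (s (Suc m))) \<le> F (S m M)"
      by (intro mono) (auto intro: le_supI1 t0)
    also have "\<dots> \<le> F (s m) + \<eta> m" unfolding s_def by (rule \<mu>)
    finally have "F (t m) + F (s (Suc m)) - (F (s m) + \<eta> m) \<le> F (t (Suc m))"
      using modular[OF t0 s0, of m "Suc m"] by (simp add: t_def)
    then show ?case using Suc by (simp add: \<eta>_def algebra_simps)
  qed (simp add: t_def)
  have t_not_le: "\<not> t m \<le> r" for m
  proof
    assume "t m \<le> r"
    then have "F (t m) \<le> F r" by (intro mono t0)
    moreover have "h \<le> F (s m)"
      using p(2)[of m] mono[OF p(1) p_S[of m m "\<mu> m"]] by (simp add: s_def)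
    moreover have "h / 2 * (1 - (1/2) ^ m) \<le> h / 2 * 1"
      using h by (intro mult_left_mono) auto
    ultimately show False using F_t[of m] r(2) by simp
  qed
  \<comment> \<open>The invariant of the selection: the current infimum \<open>x\<close> stays not
    below \<open>r\<close> after meeting it with any \<open>t m\<close>, so every later block can
    still be served.\<close>
  let ?P = "\<lambda>x. \<forall>m. \<not> inf x (t m) \<le> r"
  let ?Q = "\<lambda>n x y. \<exists>c. (\<exists>i\<ge>n. c = g i \<or> c = - g i) \<and> y = inf x c"
  have "\<exists>a. \<forall>n. ?P (a n) \<and> ?Q n (a n) (a (Suc n))"
  proof (rule dependent_nat_choice)
    show "\<exists>x. ?P x"
      using t_not_le t_anti[of 0] by (intro exI[of _ "t 0"]) (simp add: inf_absorb2)
  next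
    fix x n assume x: "?P x"
    show "\<exists>y. ?P y \<and> ?Q n x y"
    proof (rule ccontr)
      assume "\<not> ?thesis"
      \<comment> \<open>If every choice \<open>c\<close> breaks the invariant, each has its own
        failing index; the block \<open>s n\<close> offers only finitely many choices, so one index
        \<open>m\<close> serves them all.\<close>
      then have "\<exists>m. inf (inf x c) (t m) \<le> r" if "c \<in> {g i | i. i \<ge> n} \<union> {- g i | i. i \<ge> n}" for c
        using that by blast
      then obtain k where k: "\<And>i. i \<ge> n \<Longrightarrow> inf (inf x (g i)) (t (k (g i))) \<le> r"
          "\<And>i. i \<ge> n \<Longrightarrow> inf (inf x (- g i)) (t (k (- g i))) \<le> r"
        by (simp add: Bex_def) metis
      define Opts where "Opts = (\<lambda>i. g (n + i)) ` {..\<mu> n} \<union> (\<lambda>i. - g (n + i)) ` {..\<mu> n}"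
      have "finite Opts" by (simp add: Opts_def)
      \<comment> \<open>The sum dominates every \<open>k c\<close>, and the summand \<open>n\<close>
        ensures \<open>t m \<le> s n\<close>.\<close>
      define m where "m = n + sum k Opts"
      have km: "k c \<le> m" if "c \<in> Opts" for c
        using member_le_sum[OF that, of k] \<open>finite Opts\<close> by (simp add: m_def)
      have O_le: "inf (inf x (t m)) c \<le> r" if "c \<in> Opts" for c
      proof -
        have "inf (inf x (t m)) c \<le> inf (inf x c) (t (k c))"
          using t_anti[OF km[OF that]] by (simp add: inf.coboundedI1 inf.coboundedI2 le_infI1 le_infI2)
        also have "\<dots> \<le> r" using that k by (auto simp: Opts_def)
        finally show ?thesis .
      qed
      have "inf (inf x (t m)) (s n) \<le> r"
        unfolding s_def S_def
      proof (rule inf_sup_upto_le)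
        fix i assume "i \<le> \<mu> n"
        then show "inf (inf x (t m)) (p (n + i)) \<le> r"
          using O_le unfolding p_def lat_abs_def inf_sup_distrib_lattice_group
          by (intro le_supI) (auto simp: Opts_def)
      qed
      moreover have "t m \<le> s n" unfolding t_def by (intro inf_upto_lower) (simp add: m_def)
      ultimately have "inf x (t m) \<le> r" by (metis inf_absorb1 inf_assoc)
      then show False using x by blast
    qed
  qed
  then obtain a where a: "\<And>n. ?P (a n)" "\<And>n. ?Q n (a n) (a (Suc n))" by blast
  then have "\<forall>n. \<exists>c. (\<exists>i\<ge>n. c = g i \<or> c = - g i) \<and> a (Suc n) = inf (a n) c" by blast
  from choice[OF this] obtain opt
    where opts: "\<forall>n. (\<exists>i\<ge>n. opt n = g i \<or> opt n = - g i) \<and> a (Suc n) = inf (a n) (opt n)" ..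
  have opt: "\<exists>i\<ge>n. opt n = g i \<or> opt n = - g i" "a (Suc n) = inf (a n) (opt n)" for n
    using opts[THEN spec, of n, THEN conjunct1] opts[THEN spec, of n, THEN conjunct2] .
  have "a n \<le> opt j" if "j < n" for j n
  proof -
    have "a n \<le> a (Suc j)" using lift_Suc_antimono_le[of a "Suc j" n] that by (simp add: opt(2))
    then show ?thesis by (simp add: opt(2))
  qed
  moreover have "\<not> a n \<le> r" for n using a(1)[of n] by (meson le_infI1)
  ultimately show ?thesis using opt(1) by (intro exI[of _ opt] exI[of _ a] conjI allI impI)
qed

text \<open>The norm of an AL-space is additive on the cone, so it extends to a positive functional,
  the order unit of the dual.\<close>

lemma AL_unit:
  fixes J :: "'d::banach_lattice \<Rightarrow> ('a::banach_lattice \<Rightarrow>\<^sub>L real)"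
  assumes J: "dual_repr J" and AL: "AL_space TYPE('a)"
  obtains e where "0 \<le> e" "\<And>x. 0 \<le> x \<Longrightarrow> blinfun_apply (J e) x = norm x"
proof -
  obtain f :: "'a \<Rightarrow>\<^sub>L real" where f: "\<And>x. 0 \<le> x \<Longrightarrow> blinfun_apply f x = norm x"
    by (rule extend_from_cone[where q = norm and M = 1])
      (use AL in \<open>auto simp: AL_space_def\<close>)
  show thesis
  proof
    show "blinfun_apply (J (inv J f)) x = norm x" if "0 \<le> x" for x
      using f[OF that] by (simp add: dual_repr_inv[OF J])
    then show "0 \<le> inv J f" using J unfolding dual_repr_def by simp
  qed
qed

text \<open>Sign selection with \<open>r = d *\<^sub>R e\<close> gives lower bounds
  \<open>a n\<close> of the first \<open>n\<close> selected terms that are not below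
  \<open>d *\<^sub>R e\<close>. As \<open>e\<close> is the norm on the cone, \<open>a n\<close>
  exceeds \<open>d\<close> at some positive unit vector, and so do these terms. Thinning to a
  constant sign, which is absorbed into the point, finishes the argument.\<close>

lemma not_uaw_null_dual_AL:
  fixes J :: "'d::banach_lattice \<Rightarrow> ('a::banach_lattice \<Rightarrow>\<^sub>L real)"
  assumes J: "dual_repr J" and AL: "AL_space TYPE('a)"
    and bnd: "bounded (range g)" and not: "\<not> uaw_convergent_to g 0"
  obtains d s where "0 < d" "strict_mono s"
    "\<And>k::nat. \<exists>x. norm x \<le> 1 \<and> (\<forall>j\<le>k. d \<le> blinfun_apply (J (g (s j))) x)"
proof -
  obtain M where M: "\<And>i. norm (g i) \<le> M" using bnd by (auto simp: bounded_iff)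
  obtain e where e: "0 \<le> e" "\<And>x. 0 \<le> x \<Longrightarrow> blinfun_apply (J e) x = norm x"
    using AL_unit[OF J AL] by blast
  from not obtain u and \<phi> :: "'d \<Rightarrow>\<^sub>L real" where u: "0 \<le> u"
    and not_lim: "\<not> (\<lambda>n. blinfun_apply \<phi> (inf (lat_abs (g n)) u)) \<longlonglongrightarrow> 0"
    by (auto simp: uaw_convergent_to_def)
  obtain F1 :: "'d \<Rightarrow> real" where F1: "\<And>x y. 0 \<le> x \<Longrightarrow> 0 \<le> y \<Longrightarrow> F1 (x + y) = F1 x + F1 y"
    "\<And>x. 0 \<le> x \<Longrightarrow> 0 \<le> F1 x" "\<And>x. 0 \<le> x \<Longrightarrow> blinfun_apply \<phi> x \<le> F1 x"
    using positive_part_functional[of \<phi>] by blast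
  obtain F2 :: "'d \<Rightarrow> real" where F2: "\<And>x y. 0 \<le> x \<Longrightarrow> 0 \<le> y \<Longrightarrow> F2 (x + y) = F2 x + F2 y"
    "\<And>x. 0 \<le> x \<Longrightarrow> 0 \<le> F2 x" "\<And>x. 0 \<le> x \<Longrightarrow> blinfun_apply (- \<phi>) x \<le> F2 x"
    using positive_part_functional[of "- \<phi>"] by blast
  \<comment> \<open>\<open>F\<close> acts as the modulus of \<open>\<phi>\<close>: it is additive
    and monotone on the cone and dominates the absolute value of \<open>\<phi>\<close>
    there.\<close>
  define F where "F x = F1 x + F2 x" for x
  have F: "F (x + y) = F x + F y" "0 \<le> F x" "\<bar>blinfun_apply \<phi> x\<bar> \<le> F x" if "0 \<le> x" "0 \<le> y" for x y
    using F1(1)[OF that] F2(1)[OF that] F1(2,3)[OF that(1)] F2(2,3)[OF that(1)]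
    by (auto simp: F_def blinfun.minus_left)
  have F_mono: "F x \<le> F y" if "0 \<le> x" "x \<le> y" for x y
    using F(1)[of x "y - x"] F(2)[of "y - x" 0] that by simp
  obtain h where h: "0 < h" "\<And>N. \<exists>n\<ge>N. h \<le> \<bar>blinfun_apply \<phi> (inf (lat_abs (g n)) u)\<bar>"
    using not_lim unfolding LIMSEQ_iff by (auto simp: not_less)
  have large: "\<exists>n\<ge>N. h \<le> F (lat_abs (g n))" for N
  proof -
    obtain n where n: "n \<ge> N" "h \<le> \<bar>blinfun_apply \<phi> (inf (lat_abs (g n)) u)\<bar>" using h(2) by blast
    have "0 \<le> inf (lat_abs (g n)) u" using u by (simp add: lat_abs_ge)
    then have "h \<le> F (inf (lat_abs (g n)) u)" using F(3)[of _ 0] n(2) by fastforce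
    also have "\<dots> \<le> F (lat_abs (g n))" using u by (intro F_mono) (simp_all add: lat_abs_ge)
    finally show ?thesis using n(1) by blast
  qed
  obtain \<rho> :: "nat \<Rightarrow> nat" where \<rho>: "strict_mono \<rho>" "\<And>i. h \<le> F (lat_abs (g (\<rho> i)))"
  proof -
    have "infinite {n. h \<le> F (lat_abs (g n))}"
      using large by (simp add: infinite_nat_iff_unbounded_le)
    from strict_mono_enumerate[OF this] enumerate_in_set[OF this] show thesis
      by (intro that[of "enumerate {n. h \<le> F (lat_abs (g n))}"]) simp_all
  qed
  \<comment> \<open>This choice makes \<open>F (d *\<^sub>R e) = F e / (K + 1)\<close> less than
    \<open>h / 2\<close>.\<close>
  obtain K :: nat where K: "2 * F e / h < real K" using reals_Archimedean2 by blast
  define d where "d = 1 / real (Suc K)"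
  have d: "0 < d" by (simp add: d_def)
  have F_mult: "F (real n *\<^sub>R x) = real n * F x" if "0 \<le> x" for n x
  proof (induction n)
    case 0 then show ?case using F(1)[of 0 0] by simp
  next
    case (Suc n)
    then show ?case using F(1)[of "real n *\<^sub>R x" x] that
      by (simp add: scaleR_add_left scaleR_nonneg_nonneg algebra_simps)
  qed
  have de: "0 \<le> d *\<^sub>R e" using d e by (simp add: scaleR_nonneg_nonneg)
  have F_de: "F (d *\<^sub>R e) < h / 2"
  proof -
    have "real (Suc K) * F (d *\<^sub>R e) = F e"
      using F_mult[OF de, of "Suc K"] by (simp add: d_def del: of_nat_Suc)
    moreover have "2 * F e < real (Suc K) * h" using K h(1) by (simp add: field_simps)
    ultimately have "real (Suc K) * (2 * F (d *\<^sub>R e)) < real (Suc K) * h"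
      by (metis mult.left_commute)
    then have "2 * F (d *\<^sub>R e) < h" by (rule mult_left_less_imp_less) simp
    then show ?thesis by simp
  qed
  have "lat_abs (g (\<rho> i)) \<le> M *\<^sub>R e" for i
  proof -
    have "\<bar>blinfun_apply (J (g (\<rho> i))) x\<bar> \<le> M * norm x" for x
      using dual_repr_bound[OF J, of "g (\<rho> i)" x] mult_right_mono[OF M, of "norm x" "\<rho> i"] by simp
    then have "\<bar>blinfun_apply (J (g (\<rho> i))) x\<bar> \<le> blinfun_apply (J (M *\<^sub>R e)) x" if "0 \<le> x" for x
      using e(2)[OF that] by (simp add: dual_repr_scaleR[OF J] blinfun.scaleR_left)
    then have "g (\<rho> i) \<le> M *\<^sub>R e" "- g (\<rho> i) \<le> M *\<^sub>R e"
      unfolding dual_repr_le_iff[OF J]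
      by (auto simp: dual_repr_minus[OF J] blinfun.minus_left abs_le_iff)
    then show ?thesis by (simp add: lat_abs_le_iff)
  qed
  note F_bnd = this
  have "\<exists>opt a. (\<forall>n. \<exists>i\<ge>n. opt n = g (\<rho> i) \<or> opt n = - g (\<rho> i))
      \<and> (\<forall>n::nat. \<forall>j<n. a n \<le> opt j) \<and> (\<forall>n. \<not> a n \<le> d *\<^sub>R e)"
    by (rule select_signs[of F "\<lambda>i. g (\<rho> i)" "M *\<^sub>R e" h "d *\<^sub>R e",
          OF F(1) F(2)[OF _ order_refl] F_bnd h(1) \<rho>(2) de F_de])
  then obtain opt a where opt: "\<And>n. \<exists>i\<ge>n. opt n = g (\<rho> i) \<or> opt n = - g (\<rho> i)"
    and a: "\<And>j n. j < n \<Longrightarrow> a n \<le> opt j" "\<And>n. \<not> a n \<le> d *\<^sub>R e"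
    by blast
  from opt have "\<forall>n. \<exists>i. i \<ge> n \<and> (opt n = g (\<rho> i) \<or> opt n = - g (\<rho> i))" by blast
  from choice[OF this] obtain \<iota> where \<iota>: "\<And>n. \<iota> n \<ge> n"
      "\<And>n. opt n = g (\<rho> (\<iota> n)) \<or> opt n = - g (\<rho> (\<iota> n))"
    by blast
  have point: "\<exists>z. norm z \<le> 1 \<and> (\<forall>j<n. d \<le> blinfun_apply (J (opt j)) z)" for n
  proof -
    obtain z where z: "0 \<le> z" "d * norm z < blinfun_apply (J (a n)) z"
      using a(2)[of n] e(2) unfolding dual_repr_le_iff[OF J]
      by (auto simp: dual_repr_scaleR[OF J] blinfun.scaleR_left not_le)
    then have nz: "0 < norm z" by (cases "z = 0") auto
    define z' where "z' = (1 / norm z) *\<^sub>R z"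
    have z': "0 \<le> z'" "norm z' = 1" using z nz by (simp_all add: z'_def scaleR_nonneg_nonneg)
    have "d \<le> blinfun_apply (J (a n)) z'"
      using z(2) nz by (simp add: z'_def blinfun.scaleR_right field_simps)
    then have "d \<le> blinfun_apply (J (opt j)) z'" if "j < n" for j
      using dual_repr_leD[OF J a(1)[OF that] z'(1)] by simp
    then show ?thesis using z'(2) by (intro exI[of _ z']) simp
  qed
  have "infinite {j. opt j = g (\<rho> (\<iota> j))} \<or> infinite {j. opt j = - g (\<rho> (\<iota> j))}"
  proof (rule ccontr)
    assume "\<not> ?thesis"
    then have "finite ({j. opt j = g (\<rho> (\<iota> j))} \<union> {j. opt j = - g (\<rho> (\<iota> j))})" by simp
    moreover have "{j. opt j = g (\<rho> (\<iota> j))} \<union> {j. opt j = - g (\<rho> (\<iota> j))} = UNIV" using \<iota>(2) by auto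
    ultimately show False by simp
  qed
  then have "\<exists>\<sigma>::real. \<bar>\<sigma>\<bar> = 1 \<and> infinite {j. opt j = \<sigma> *\<^sub>R g (\<rho> (\<iota> j))}"
    by (elim disjE) (rule exI[of _ 1], simp, rule exI[of _ "-1"], simp)
  then obtain \<sigma> :: real where \<sigma>: "\<bar>\<sigma>\<bar> = 1" "infinite {j. opt j = \<sigma> *\<^sub>R g (\<rho> (\<iota> j))}"
    by blast
  define A where "A = {j. opt j = \<sigma> *\<^sub>R g (\<rho> (\<iota> j))}"
  \<comment> \<open>Since \<open>\<iota> y \<ge> y\<close>, the infinite set \<open>A\<close> has
    members with arbitrarily large \<open>\<iota>\<close>. Only \<open>\<iota> (\<alpha> n)\<close>
    is recorded as increasing, so \<open>\<alpha> 0, ..., \<alpha> k\<close> are later bounded by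
    their maximum.\<close>
  have "\<exists>\<alpha>. \<forall>n. \<alpha> n \<in> A \<and> \<iota> (\<alpha> n) < \<iota> (\<alpha> (Suc n))"
  proof (rule dependent_nat_choice)
    show "\<exists>x. x \<in> A" using infinite_imp_nonempty[OF \<sigma>(2)] unfolding A_def by blast
  next
    fix x
    obtain y where "y \<in> A" "y > \<iota> x"
      using \<sigma>(2) unfolding A_def[symmetric] infinite_nat_iff_unbounded by blast
    then show "\<exists>y. y \<in> A \<and> \<iota> x < \<iota> y" using \<iota>(1)[of y] by (intro exI[of _ y]) simp
  qed
  then obtain \<alpha> where \<alpha>: "\<And>n. \<alpha> n \<in> A" "\<And>n. \<iota> (\<alpha> n) < \<iota> (\<alpha> (Suc n))" by blast
  show thesis
  proof
    show "0 < d" by (rule d)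
    show "strict_mono (\<lambda>n. \<rho> (\<iota> (\<alpha> n)))"
      using \<rho>(1) \<alpha>(2) by (simp add: strict_mono_Suc_iff strict_mono_less)
    fix k
    obtain z where z: "norm z \<le> 1" "\<And>j. j < Suc (Max (\<alpha> ` {..k})) \<Longrightarrow> d \<le> blinfun_apply (J (opt j)) z"
      using point by blast
    have "d \<le> blinfun_apply (J (g (\<rho> (\<iota> (\<alpha> j))))) (\<sigma> *\<^sub>R z)" if "j \<le> k" for j
    proof -
      have "\<alpha> j < Suc (Max (\<alpha> ` {..k}))" using that by (simp add: less_Suc_eq_le)
      from z(2)[OF this] \<alpha>(1)[of j] show ?thesis
        by (simp add: A_def dual_repr_scaleR[OF J] blinfun.scaleR_left blinfun.scaleR_right)
    qed
    then show "\<exists>x. norm x \<le> 1 \<and> (\<forall>j\<le>k. d \<le> blinfun_apply (J (g (\<rho> (\<iota> (\<alpha> j))))) x)"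
      using z(1) \<sigma>(1) by (intro exI[of _ "\<sigma> *\<^sub>R z"]) simp
  qed
qed

subsection \<open>The adjoint\<close>

text \<open>One vector is kept for each finite list of indices and each rational threshold. A
  rational between \<open>d / 2\<close> and \<open>d\<close> reduces a real bound to this countable
  family.\<close>

lemma countable_test_vectors:
  fixes G :: "nat \<Rightarrow> 'a::real_normed_vector \<Rightarrow>\<^sub>L real"
  shows "\<exists>c::nat \<Rightarrow> 'a. (\<forall>n. norm (c n) \<le> 1) \<and>
    (\<forall>I x d. finite I \<longrightarrow> norm x \<le> 1 \<longrightarrow> 0 < d \<longrightarrow> (\<forall>i\<in>I. d \<le> blinfun_apply (G i) x)
      \<longrightarrow> (\<exists>n. \<forall>i\<in>I. d / 2 \<le> blinfun_apply (G i) (c n)))"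
proof -
  let ?P = "\<lambda>(l, q) x. norm x \<le> 1 \<and> (\<forall>i\<in>set l. real_of_rat q \<le> blinfun_apply (G i) x)"
  \<comment> \<open>The default 0 keeps unattainable requests inside the unit ball.\<close>
  define c' where "c' k = (if \<exists>x. ?P k x then SOME x. ?P k x else 0)" for k :: "nat list \<times> rat"
  define c where "c n = c' (from_nat n)" for n
  have c': "?P k (c' k)" if "\<exists>x. ?P k x" for k
    using someI_ex[OF that] that by (simp add: c'_def)
  show ?thesis
  proof (intro exI[of _ c] conjI allI impI)
    show "norm (c n) \<le> 1" for n
      using c'[of "from_nat n"] by (cases "\<exists>x. ?P (from_nat n) x") (auto simp: c_def c'_def split: prod.splits)
    fix I x d assume I: "finite I" and x: "norm x \<le> 1" and d: "0 < (d::real)"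
      and low: "\<forall>i\<in>I. d \<le> blinfun_apply (G i) x"
    obtain l where l: "set l = I" using finite_list[OF I] by blast
    obtain q where q: "d / 2 < real_of_rat q" "real_of_rat q < d"
      using of_rat_dense[of "d / 2" d] d by auto
    have "?P (l, q) x" using l q x low by force
    then have "?P (l, q) (c' (l, q))" by (intro c') blast
    then have "\<forall>i\<in>I. d / 2 \<le> blinfun_apply (G i) (c (to_nat (l, q)))"
      using l q by (force simp: c_def)
    then show "\<exists>n. \<forall>i\<in>I. d / 2 \<le> blinfun_apply (G i) (c n)" by blast
  qed
qed

theorem theorem2p11:
  fixes T :: "'e::banach_lattice \<Rightarrow>\<^sub>L 'f::banach_lattice"
    and JE :: "'ed::banach_lattice \<Rightarrow> ('e \<Rightarrow>\<^sub>L real)"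
    and JF :: "'fd::banach_lattice \<Rightarrow> ('f \<Rightarrow>\<^sub>L real)"
  assumes "AL_space TYPE('e)"
    and "dual_repr JE"
    and "dual_repr JF"
    and "order_continuous TYPE('fd)"
    and "seq_uaw_compact (blinfun_apply T)"
  shows "seq_uaw_compact (adjoint_op JE JF T)"
  unfolding seq_uaw_compact_def
proof (intro allI impI)
  fix xs :: "nat \<Rightarrow> 'fd" assume bnd: "bounded (range xs)"
  note JE = assms(2) and JF = assms(3)
  define f where "f n = JF (xs n)" for n
  obtain M where M: "\<And>n. norm (f n) \<le> M"
    using bnd by (auto simp: bounded_iff f_def dual_repr_norm[OF JF])
  then have "bounded (range f)" by (auto simp: bounded_iff)
  then obtain f0 where f0: "weak_star_cluster f f0" by (rule ex_weak_star_cluster)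
  define G where "G n = (f n - f0) o\<^sub>L T" for n
  \<comment> \<open>The test vectors are taken for the whole sequence \<open>G\<close>, before
    passing to a subsequence, so that \<open>r\<close> can be made to converge at all their
    images.\<close>
  obtain c :: "nat \<Rightarrow> 'e" where c: "\<forall>n. norm (c n) \<le> 1"
    "\<forall>I x d. finite I \<longrightarrow> norm x \<le> 1 \<longrightarrow> 0 < d \<longrightarrow> (\<forall>i\<in>I. d \<le> blinfun_apply (G i) x)
      \<longrightarrow> (\<exists>n. \<forall>i\<in>I. d / 2 \<le> blinfun_apply (G i) (c n))"
    using countable_test_vectors[of G] by (elim exE conjE)
  obtain r where r: "strict_mono r"
    and r_lim: "\<And>l. (\<lambda>i. blinfun_apply (f (r i)) (blinfun_apply T (c l))) \<longlonglongrightarrow> blinfun_apply f0 (blinfun_apply T (c l))"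
    using weak_star_cluster_subseq[OF f0, of "\<lambda>l. blinfun_apply T (c l)"] by metis
  define y where "y = inv JE (f0 o\<^sub>L T)"
  define g where "g n = adjoint_op JE JF T (xs (r n)) - y" for n
  have Jg: "JE (g n) = G (r n)" for n
    by (rule blinfun_eqI) (simp add: g_def y_def adjoint_op_def dual_repr_diff[OF JE] dual_repr_inv[OF JE]
        G_def f_def blinfun.diff_left)
  have "uaw_convergent_to g 0"
  proof (rule ccontr)
    assume not: "\<not> uaw_convergent_to g 0"
    have "norm (g n) \<le> (M + norm f0) * norm T" for n
    proof -
      have "norm (g n) \<le> norm (f (r n) - f0) * norm T"
        using norm_blinfun_compose[of "f (r n) - f0" T] dual_repr_norm[OF JE, of "g n"] by (simp add: Jg G_def)
      also have "\<dots> \<le> (M + norm f0) * norm T"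
        using norm_triangle_ineq4[of "f (r n)" f0] M[of "r n"] by (intro mult_right_mono) auto
      finally show ?thesis .
    qed
    then have "bounded (range g)" by (auto simp: bounded_iff)
    then obtain d s where d: "0 < d" and s: "strict_mono s"
      and test: "\<And>k::nat. \<exists>x. norm x \<le> 1 \<and> (\<forall>j\<le>k. d \<le> blinfun_apply (JE (g (s j))) x)"
      using not_uaw_null_dual_AL[OF JE assms(1) _ not] by metis
    \<comment> \<open>Points of the ball are exchanged for test vectors at the cost of halving
      \<open>d\<close>.\<close>
    have "\<exists>n. \<forall>j\<le>k. d / 2 \<le> blinfun_apply (G (r (s j))) (c n)" for k
    proof -
      obtain x where x: "norm x \<le> 1" "\<forall>j\<le>k. d \<le> blinfun_apply (G (r (s j))) x"
        using test[of k] by (auto simp: Jg)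
      then have "\<exists>n. \<forall>i\<in>(\<lambda>j. r (s j)) ` {..k}. d / 2 \<le> blinfun_apply (G i) (c n)"
        using d by (intro c(2)[rule_format, of _ x]) auto
      then show ?thesis by auto
    qed
    then obtain m where m: "\<And>k j. j \<le> k \<Longrightarrow> d / 2 \<le> blinfun_apply (G (r (s j))) (c (m k))"
      by metis
    have "bounded (range (\<lambda>k. c (m k)))" using c(1) by (auto simp: bounded_iff)
    then obtain \<rho> z where \<rho>: "strict_mono \<rho>"
      and uaw: "uaw_convergent_to (\<lambda>k. blinfun_apply T (c (m (\<rho> k)))) z"
      using assms(5) unfolding seq_uaw_compact_def by meson
    have "norm (blinfun_apply T (c n)) \<le> norm T" for n
      using norm_blinfun[of T "c n"] mult_left_mono[OF c(1)[rule_format, of n], of "norm T"] by simp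
    then have "bounded (range (\<lambda>k. blinfun_apply T (c (m (\<rho> k)))))" by (auto simp: bounded_iff)
    from uaw_imp_weak[OF JF assms(4) this uaw]
    have weak: "(\<lambda>k. blinfun_apply h (blinfun_apply T (c (m (\<rho> k))))) \<longlonglongrightarrow> blinfun_apply h z" for h :: "'f \<Rightarrow>\<^sub>L real" .
    define F where "F j = f (r (s j)) - f0" for j
    \<comment> \<open>For fixed \<open>j\<close> the bound holds at
      \<open>T (c (m (\<rho> k)))\<close> for all \<open>k \<ge> j\<close>, so it survives the weak
      limit in \<open>k\<close>.\<close>
    have F_z: "d / 2 \<le> blinfun_apply (F j) z" for j
    proof (rule LIMSEQ_le_const[OF weak], intro exI allI impI)
      fix k assume "j \<le> k"
      then have "j \<le> \<rho> k" using seq_suble[OF \<rho>, of k] by simp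
      from m[OF this] show "d / 2 \<le> blinfun_apply (F j) (blinfun_apply T (c (m (\<rho> k))))"
        by (simp add: G_def F_def)
    qed
    have "norm (F j) \<le> M + norm f0" for j
      using norm_triangle_ineq4[of "f (r (s j))" f0] M[of "r (s j)"] by (simp add: F_def)
    then have "bounded (range F)" by (auto simp: bounded_iff)
    \<comment> \<open>The limits in \<open>j\<close> and \<open>k\<close> cannot simply be
      exchanged. The cluster point \<open>F0\<close> is a single continuous functional that vanishes
      at every \<open>T (c l)\<close>, hence at their weak limit \<open>z\<close>, and yet inherits
      the lower bound at \<open>z\<close>.\<close>
    then obtain F0 where F0: "weak_star_cluster F F0" by (rule ex_weak_star_cluster)
    have "blinfun_apply F0 (blinfun_apply T (c l)) = 0" for l
    proof (rule weak_star_cluster_unique[OF F0])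
      have "(\<lambda>j. blinfun_apply (f (r (s j))) (blinfun_apply T (c l))) \<longlonglongrightarrow> blinfun_apply f0 (blinfun_apply T (c l))"
        using LIMSEQ_subseq_LIMSEQ[OF r_lim s] by (simp add: o_def)
      then show "(\<lambda>j. blinfun_apply (F j) (blinfun_apply T (c l))) \<longlonglongrightarrow> 0"
        by (simp add: F_def blinfun.diff_left LIM_zero_iff)
    qed
    then have "blinfun_apply F0 z = 0" using weak[of F0] by (simp add: LIMSEQ_const_iff)
    moreover have "d / 2 \<le> blinfun_apply F0 z" using F0 F_z by (rule weak_star_cluster_ge)
    ultimately show False using d by simp
  qed
  then have "uaw_convergent_to (\<lambda>n. adjoint_op JE JF T (xs (r n))) y"
    by (simp add: uaw_convergent_to_def g_def)
  with r show "\<exists>r y. strict_mono r \<and> uaw_convergent_to (\<lambda>n. adjoint_op JE JF T (xs (r n))) y"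
    by blast
qed

end
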